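(* The finiteness problem is solvable for the class Surface: there is an algorithm that, given (a description of) a tree language $U$ in Surface, decides whether $U$ is finite.
   Context: Alphabets are finite. A ranked alphabet $\Sigma$ is a finite set of symbols with, for each $k\ge 0$, a subset $\Sigma_k$ (symbols of rank $k$; a symbol may have several ranks), $\Sigma=\bigcup_k\Sigma_k$, only finitely many $\Sigma_k$ nonempty. $T_\Sigma$ is the set of trees over $\Sigma$: $a\in T_\Sigma$ for $a\in\Sigma_0$, and $a[t_1\cdots t_k]\in T_\Sigma$ for $k\ge1$, $a\in\Sigma_k$, $t_i\in T_\Sigma$. A tree transformation from $T_\Sigma$ into $T_\Delta$ is a subset of $T_\Sigma\times T_\Delta$; maps $f:T_\Sigma\to T_\Delta$ are identified with $\{(s,t)\mid f(s)=t\}$ and maps $f:T_\Sigma\to\mathcal P(T_\Delta)$ with $\{(s,t)\mid t\in f(s)\}$. $M_1\circ M_2=\{(s,t)\mid (s,u)\in M_1,(u,t)\in M_2\text{ for some }u\}$ ($M_1$ applied first). $M(L)=\{t\mid(s,t)\in M\text{ for some }s\in L\}$. $X_k=\{x_1,\dots,x_k\}$ are variables; $T_\Delta(X_k)$ is the set of trees over $\Delta\cup X_k$, variables having rank $0$. Recognizable tree languages (class RECOG): $L=\{t\in T_\Sigma\mid\widehat\delta(t)\in F\}$ for some finite set $Q$, $F\subseteq Q$, $s_a\in Q$ ($a\in\Sigma_0$), $\delta_a^k:Q^k\to Q$ ($k\ge1,a\in\Sigma_k$), where $\widehat\delta(a)=s_a$, $\widehat\delta(a[t_1\cdots t_k])=\delta_a^k(\widehat\delta(t_1),\dots,\widehat\delta(t_k))$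 (a deterministic bottom-up finite tree automaton). $REL$ (relabelings): families of maps $r_k:\Sigma_k\to\mathcal P(\Delta_k)$, acting by $r(a)=r_0(a)$, $r(a[t_1\cdots t_k])=\{b[s_1\cdots s_k]\mid b\in r_k(a),s_i\in r(t_i)\}$. $FTA$ (finite tree automaton restrictions): $\{(t,t)\mid t\in L\}$ with $L$ recognizable. $HOM$ (tree homomorphisms): families of maps $h_k:\Sigma_k\to T_\Delta(X_k)$, acting by $h(a)=h_0(a)$, $h(a[t_1\cdots t_k])=h_k(a)\langle x_1\gets h(t_1),\dots,x_k\gets h(t_k)\rangle$ (simultaneous substitution). $(REL\cup FTA\cup HOM)^*$ is the class of all compositions $M_1\circ\cdots\circ M_n$, $n\ge1$, with each $M_i\in REL\cup FTA\cup HOM$. Surface is the class of tree languages $M(L)$ with $M\in(REL\cup FTA\cup HOM)^*$ and $L\in\mathrm{RECOG}$. A language in Surface is given by a finite tree automaton for $L$ and the finite sequence $M_1,\dots,M_n$, each $M_i$ given by its defining finite data (the maps $r_k$, a finite tree automaton, or the maps $h_k$). *)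

theory Defs
  imports Main "HOL-Library.Nat_Bijection"
begin

section \<open>Trees over ranked alphabets\<close>

text \<open>A symbol may have several ranks; a leaf \<open>a\<close> is \<open>Node a []\<close>.\<close>

datatype 'a tree = Node 'a "'a tree list"

type_synonym 'a ranked = "nat \<Rightarrow> 'a set"

definition ranked_alphabet :: "'a ranked \<Rightarrow> bool" where
  "ranked_alphabet Sg \<longleftrightarrow> finite (\<Union>k. Sg k) \<and> finite {k. Sg k \<noteq> {}}"

inductive_set trees :: "'a ranked \<Rightarrow> 'a tree set" for Sg where
  "a \<in> Sg (length ts) \<Longrightarrow> (\<And>t. t \<in> set ts \<Longrightarrow> t \<in> trees Sg) \<Longrightarrow> Node a ts \<in> trees Sg"

text \<open>
  Trees with variables. The variables are numbered from 0, so that \<open>X\<^sub>k\<close> is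
  \<open>Var 0, \<dots>, Var (k - 1)\<close>.
\<close>

datatype 'a vtree = Var nat | VNode 'a "'a vtree list"

inductive_set vtrees :: "'a ranked \<Rightarrow> nat \<Rightarrow> 'a vtree set" for Dl k where
  "i < k \<Longrightarrow> Var i \<in> vtrees Dl k"
| "a \<in> Dl (length vs) \<Longrightarrow> (\<And>v. v \<in> set vs \<Longrightarrow> v \<in> vtrees Dl k) \<Longrightarrow> VNode a vs \<in> vtrees Dl k"

primrec subst :: "'a tree list \<Rightarrow> 'a vtree \<Rightarrow> 'a tree" where
  "subst ts (Var i) = ts ! i"
| "subst ts (VNode a vs) = Node a (map (subst ts) vs)"


section \<open>Recognizable tree languages\<close>

text \<open>
  \<open>\<delta> a [q\<^sub>1, \<dots>, q\<^sub>k]\<close> is \<open>\<delta>\<^sub>a\<^sup>k(q\<^sub>1, \<dots>, q\<^sub>k)\<close>, and \<open>\<delta> a []\<close> is the initial state \<open>s\<^sub>a\<close>.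
  As state sets are finite, states are natural numbers without loss of generality.
\<close>

definition fta :: "'a ranked \<Rightarrow> nat set \<Rightarrow> nat set \<Rightarrow> ('a \<Rightarrow> nat list \<Rightarrow> nat) \<Rightarrow> bool" where
  "fta Sg Q F \<delta> \<longleftrightarrow> ranked_alphabet Sg \<and> finite Q \<and> F \<subseteq> Q \<and>
     (\<forall>a qs. a \<in> Sg (length qs) \<longrightarrow> set qs \<subseteq> Q \<longrightarrow> \<delta> a qs \<in> Q)"

primrec run :: "('a \<Rightarrow> nat list \<Rightarrow> nat) \<Rightarrow> 'a tree \<Rightarrow> nat" where
  "run \<delta> (Node a ts) = \<delta> a (map (run \<delta>) ts)"

definition fta_lang :: "'a ranked \<Rightarrow> nat set \<Rightarrow> ('a \<Rightarrow> nat list \<Rightarrow> nat) \<Rightarrow> 'a tree set" where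
  "fta_lang Sg F \<delta> = {t \<in> trees Sg. run \<delta> t \<in> F}"

definition RECOG :: "'a tree set set" where
  "RECOG = {fta_lang Sg F \<delta> | Sg Q F \<delta>. fta Sg Q F \<delta>}"


section \<open>Relabelings, finite tree automaton restrictions, homomorphisms\<close>

definition relabeling :: "'a ranked \<Rightarrow> 'a ranked \<Rightarrow> (nat \<Rightarrow> 'a \<Rightarrow> 'a set) \<Rightarrow> bool" where
  "relabeling Sg Dl r \<longleftrightarrow> ranked_alphabet Sg \<and> ranked_alphabet Dl \<and>
     (\<forall>k. \<forall>a \<in> Sg k. r k a \<subseteq> Dl k)"

inductive relabels :: "(nat \<Rightarrow> 'a \<Rightarrow> 'a set) \<Rightarrow> 'a tree \<Rightarrow> 'a tree \<Rightarrow> bool" for r where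
  "b \<in> r (length ts) a \<Longrightarrow> list_all2 (relabels r) ts ss \<Longrightarrow> relabels r (Node a ts) (Node b ss)"

definition rel_trans :: "'a ranked \<Rightarrow> (nat \<Rightarrow> 'a \<Rightarrow> 'a set) \<Rightarrow> ('a tree \<times> 'a tree) set" where
  "rel_trans Sg r = {(s, t). s \<in> trees Sg \<and> relabels r s t}"

definition REL :: "('a tree \<times> 'a tree) set set" where
  "REL = {rel_trans Sg r | Sg Dl r. relabeling Sg Dl r}"

definition FTA :: "('a tree \<times> 'a tree) set set" where
  "FTA = {Id_on L | L. L \<in> RECOG}"

definition homomorphism :: "'a ranked \<Rightarrow> 'a ranked \<Rightarrow> (nat \<Rightarrow> 'a \<Rightarrow> 'a vtree) \<Rightarrow> bool" where
  "homomorphism Sg Dl h \<longleftrightarrow> ranked_alphabet Sg \<and> ranked_alphabet Dl \<and>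
     (\<forall>k. \<forall>a \<in> Sg k. h k a \<in> vtrees Dl k)"

primrec hom :: "(nat \<Rightarrow> 'a \<Rightarrow> 'a vtree) \<Rightarrow> 'a tree \<Rightarrow> 'a tree" where
  "hom h (Node a ts) = subst (map (hom h) ts) (h (length ts) a)"

definition hom_trans :: "'a ranked \<Rightarrow> (nat \<Rightarrow> 'a \<Rightarrow> 'a vtree) \<Rightarrow> ('a tree \<times> 'a tree) set" where
  "hom_trans Sg h = {(s, t). s \<in> trees Sg \<and> t = hom h s}"

definition HOM :: "('a tree \<times> 'a tree) set set" where
  "HOM = {hom_trans Sg h | Sg Dl h. homomorphism Sg Dl h}"


section \<open>The class Surface\<close>

text \<open>In \<open>M O N\<close> the relation \<open>M\<close> is applied first.\<close>

definition compose :: "('b \<times> 'b) set list \<Rightarrow> ('b \<times> 'b) set" where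
  "compose Ms = foldr (O) Ms Id"

definition compositions :: "('b \<times> 'b) set set \<Rightarrow> ('b \<times> 'b) set set" where
  "compositions C = {compose Ms | Ms. Ms \<noteq> [] \<and> set Ms \<subseteq> C}"

definition Surface :: "'a tree set set" where
  "Surface = {M `` L | M L. M \<in> compositions (REL \<union> FTA \<union> HOM) \<and> L \<in> RECOG}"


section \<open>Finite descriptions\<close>

text \<open>
  As alphabets are finite, symbols are natural numbers without loss of generality. An alphabet
  is a list of pairs (symbol, rank).
\<close>

type_synonym alph_desc = "(nat \<times> nat) list"

definition alph_of :: "alph_desc \<Rightarrow> nat ranked" where
  "alph_of A = (\<lambda>k. {a. (a, k) \<in> set A})"

text \<open>Alphabet, states, final states, and the transition table with its entries \<open>((a, qs), \<delta> a qs)\<close>.\<close>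

datatype fta_desc = FtaDesc alph_desc "nat list" "nat list" "((nat \<times> nat list) \<times> nat) list"

definition table_fun :: "('b \<times> 'c) list \<Rightarrow> 'b \<Rightarrow> 'c" where
  "table_fun T x = the (map_of T x)"

fun valid_fta :: "fta_desc \<Rightarrow> bool" where
  "valid_fta (FtaDesc A Q F T) \<longleftrightarrow>
     (\<forall>a qs. a \<in> alph_of A (length qs) \<longrightarrow> set qs \<subseteq> set Q \<longrightarrow> (a, qs) \<in> fst ` set T) \<and>
     fta (alph_of A) (set Q) (set F) (\<lambda>a qs. table_fun T (a, qs))"

fun lang_of_fta :: "fta_desc \<Rightarrow> nat tree set" where
  "lang_of_fta (FtaDesc A Q F T) = fta_lang (alph_of A) (set F) (\<lambda>a qs. table_fun T (a, qs))"

text \<open>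
  A relabeling is the list of all \<open>(a, k, b)\<close> with \<open>b \<in> r\<^sub>k(a)\<close>; a homomorphism is a table with
  entries \<open>((a, k), h\<^sub>k(a))\<close>. Both are preceded by their input and output alphabets.
\<close>

datatype trans_desc =
    RelDesc alph_desc alph_desc "(nat \<times> nat \<times> nat) list"
  | RestrDesc fta_desc
  | HomDesc alph_desc alph_desc "((nat \<times> nat) \<times> nat vtree) list"

fun valid_trans :: "trans_desc \<Rightarrow> bool" where
  "valid_trans (RelDesc A B R) \<longleftrightarrow> relabeling (alph_of A) (alph_of B) (\<lambda>k a. {b. (a, k, b) \<in> set R})"
| "valid_trans (RestrDesc D) \<longleftrightarrow> valid_fta D"
| "valid_trans (HomDesc A B H) \<longleftrightarrow> set A \<subseteq> fst ` set H \<and>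
     homomorphism (alph_of A) (alph_of B) (\<lambda>k a. table_fun H (a, k))"

fun trans_of :: "trans_desc \<Rightarrow> (nat tree \<times> nat tree) set" where
  "trans_of (RelDesc A B R) = rel_trans (alph_of A) (\<lambda>k a. {b. (a, k, b) \<in> set R})"
| "trans_of (RestrDesc D) = Id_on (lang_of_fta D)"
| "trans_of (HomDesc A B H) = hom_trans (alph_of A) (\<lambda>k a. table_fun H (a, k))"

datatype surface_desc = SurfaceDesc fta_desc "trans_desc list"

fun describes :: "surface_desc \<Rightarrow> nat tree set \<Rightarrow> bool" where
  "describes (SurfaceDesc D Ds) U \<longleftrightarrow> valid_fta D \<and> Ds \<noteq> [] \<and> (\<forall>E \<in> set Ds. valid_trans E) \<and>
     U = compose (map trans_of Ds) `` lang_of_fta D"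


subsection \<open>Exactly the languages in Surface have a description\<close>

lemma ranked_alphabet_alph_of: "ranked_alphabet (alph_of A)"
proof -
  have "(\<Union>k. alph_of A k) \<subseteq> fst ` set A" "{k. alph_of A k \<noteq> {}} \<subseteq> snd ` set A"
    by (force simp: alph_of_def)+
  then show ?thesis
    unfolding ranked_alphabet_def by (meson finite_imageI finite_set finite_subset)
qed

lemma ex_alph_of:
  assumes "ranked_alphabet Sg" shows "\<exists>A. alph_of A = Sg"
proof -
  have "{(a, k). a \<in> Sg k} \<subseteq> (\<Union>k. Sg k) \<times> {k. Sg k \<noteq> {}}" by auto
  then have "finite {(a, k). a \<in> Sg k}"
    using assms unfolding ranked_alphabet_def by (meson finite_SigmaI finite_subset)
  then obtain A where "set A = {(a, k). a \<in> Sg k}" using finite_list by blast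
  then show ?thesis by (intro exI[of _ A]) (auto simp: alph_of_def)
qed

lemma table_fun_map: "x \<in> set xs \<Longrightarrow> table_fun (map (\<lambda>x. (x, f x)) xs) x = f x"
  by (simp add: table_fun_def map_of_map_restrict)

lemma run_cong:
  assumes "t \<in> trees Sg" "fta Sg Q F \<delta>"
    and "\<And>a qs. a \<in> Sg (length qs) \<Longrightarrow> set qs \<subseteq> Q \<Longrightarrow> \<delta>' a qs = \<delta> a qs"
  shows "run \<delta>' t = run \<delta> t \<and> run \<delta> t \<in> Q"
  using assms(1)
proof induction
  case (1 a ts)
  then have eq: "map (run \<delta>') ts = map (run \<delta>) ts" and sub: "set (map (run \<delta>) ts) \<subseteq> Q" by auto
  have "a \<in> Sg (length (map (run \<delta>) ts))" using 1 by simp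
  then show ?case using assms(2,3) eq sub unfolding fta_def run.simps by metis
qed

lemma ex_fta_desc:
  assumes "fta Sg Q F \<delta>" shows "\<exists>D. valid_fta D \<and> lang_of_fta D = fta_lang Sg F \<delta>"
proof -
  have fin: "ranked_alphabet Sg" "finite Q" "finite F"
    using assms finite_subset unfolding fta_def by auto
  obtain A where A: "alph_of A = Sg" using ex_alph_of fin by blast
  obtain Q' where Q': "set Q' = Q" using finite_list fin by blast
  obtain F' where F': "set F' = F" using finite_list fin by blast
  let ?P = "{(a, qs). a \<in> Sg (length qs) \<and> set qs \<subseteq> Q}"
  have "?P \<subseteq> (\<Union>k. Sg k) \<times> (\<Union>k \<in> {k. Sg k \<noteq> {}}. {qs. set qs \<subseteq> Q \<and> length qs = k})" by auto
  moreover have "finite (\<Union>k \<in> {k. Sg k \<noteq> {}}. {qs. set qs \<subseteq> Q \<and> length qs = k})"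
    using fin(1) finite_lists_length_eq[OF fin(2)] unfolding ranked_alphabet_def by blast
  then have "finite ((\<Union>k. Sg k) \<times> (\<Union>k \<in> {k. Sg k \<noteq> {}}. {qs. set qs \<subseteq> Q \<and> length qs = k}))"
    using fin(1) finite_cartesian_product unfolding ranked_alphabet_def by blast
  ultimately have "finite ?P" by (rule finite_subset)
  from finite_list[OF this] obtain ps where ps: "set ps = ?P" by (elim exE)
  define T where "T = map (\<lambda>x. (x, \<delta> (fst x) (snd x))) ps"
  have T: "table_fun T (a, qs) = \<delta> a qs" if "a \<in> Sg (length qs)" "set qs \<subseteq> Q" for a qs
    unfolding T_def by (subst table_fun_map) (use ps that in auto)
  have keys: "(a, qs) \<in> fst ` set T" if "a \<in> Sg (length qs)" "set qs \<subseteq> Q" for a qs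
    using that ps unfolding T_def by (force simp: image_image)
  have "valid_fta (FtaDesc A Q' F' T)"
    using assms T keys by (simp add: A Q' F' fta_def)
  moreover have "lang_of_fta (FtaDesc A Q' F' T) = fta_lang Sg F \<delta>"
    using run_cong[OF _ assms T] by (auto simp: A F' fta_lang_def)
  ultimately show ?thesis by blast
qed

lemma RECOG_iff: "L \<in> RECOG \<longleftrightarrow> (\<exists>D. valid_fta D \<and> lang_of_fta D = L)"
proof
  assume "L \<in> RECOG" then show "\<exists>D. valid_fta D \<and> lang_of_fta D = L"
    using ex_fta_desc unfolding RECOG_def by blast
next
  assume "\<exists>D. valid_fta D \<and> lang_of_fta D = L"
  then obtain D where D: "valid_fta D" "lang_of_fta D = L" by blast
  show "L \<in> RECOG" using D unfolding RECOG_def by (cases D) force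
qed

lemma relabels_cong:
  assumes "s \<in> trees Sg" "\<And>k a. a \<in> Sg k \<Longrightarrow> r' k a = r k a"
  shows "relabels r' s t \<longleftrightarrow> relabels r s t"
  using assms(1)
proof (induction arbitrary: t)
  case (1 a ts)
  have "list_all2 (relabels r') ts ss \<longleftrightarrow> list_all2 (relabels r) ts ss" for ss
    using "1.IH" by (intro list.rel_cong) auto
  then show ?case using "1.hyps"(1) assms(2) by (auto simp: relabels.simps[of _ "Node a ts"])
qed

lemma ex_rel_desc:
  assumes "relabeling Sg Dl r" shows "\<exists>E. valid_trans E \<and> trans_of E = rel_trans Sg r"
proof -
  have ra: "ranked_alphabet Sg" "ranked_alphabet Dl" using assms unfolding relabeling_def by auto
  obtain A B where A: "alph_of A = Sg" and B: "alph_of B = Dl" using ex_alph_of ra by metis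
  have "{(a, k, b). a \<in> Sg k \<and> b \<in> r k a} \<subseteq> (\<Union>k. Sg k) \<times> {k. Sg k \<noteq> {}} \<times> (\<Union>k. Dl k)"
    using assms unfolding relabeling_def by fast
  then have "finite {(a, k, b). a \<in> Sg k \<and> b \<in> r k a}"
    using ra unfolding ranked_alphabet_def by (meson finite_SigmaI finite_subset)
  then obtain R where R: "set R = {(a, k, b). a \<in> Sg k \<and> b \<in> r k a}" using finite_list by blast
  have "valid_trans (RelDesc A B R)" using assms by (auto simp: A B R relabeling_def)
  moreover have "trans_of (RelDesc A B R) = rel_trans Sg r"
  proof -
    have "relabels (\<lambda>k a. {b. (a, k, b) \<in> set R}) s t \<longleftrightarrow> relabels r s t" if "s \<in> trees Sg" for s t
      by (rule relabels_cong[OF that]) (simp add: R)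
    then show ?thesis by (auto simp: A rel_trans_def)
  qed
  ultimately show ?thesis by blast
qed

lemma hom_cong:
  assumes "s \<in> trees Sg" "\<And>k a. a \<in> Sg k \<Longrightarrow> h' k a = h k a"
  shows "hom h' s = hom h s"
  using assms(1)
proof induction
  case (1 a ts)
  then have "map (hom h') ts = map (hom h) ts" by auto
  then show ?case using 1 assms(2) by (simp del: map_eq_conv)
qed

lemma ex_hom_desc:
  assumes "homomorphism Sg Dl h" shows "\<exists>E. valid_trans E \<and> trans_of E = hom_trans Sg h"
proof -
  have ra: "ranked_alphabet Sg" "ranked_alphabet Dl" using assms unfolding homomorphism_def by auto
  obtain A B where A: "alph_of A = Sg" and B: "alph_of B = Dl" using ex_alph_of ra by metis
  define H where "H = map (\<lambda>x. (x, h (snd x) (fst x))) A"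
  have inA: "(a, k) \<in> set A \<longleftrightarrow> a \<in> Sg k" for a k using A by (auto simp: alph_of_def)
  have H: "table_fun H (a, k) = h k a" if "a \<in> Sg k" for a k
    unfolding H_def by (subst table_fun_map) (use inA that in auto)
  have "set A \<subseteq> fst ` set H" unfolding H_def by (force simp: image_image)
  then have "valid_trans (HomDesc A B H)" using assms H by (simp add: A B homomorphism_def)
  moreover have "trans_of (HomDesc A B H) = hom_trans Sg h"
    using hom_cong[where Sg = Sg and h = h and h' = "\<lambda>k a. table_fun H (a, k)"] H
    by (auto simp: A hom_trans_def)
  ultimately show ?thesis by blast
qed

lemma trans_iff: "M \<in> REL \<union> FTA \<union> HOM \<longleftrightarrow> (\<exists>E. valid_trans E \<and> trans_of E = M)"
proof
  assume "M \<in> REL \<union> FTA \<union> HOM"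
  then consider "M \<in> REL" | "M \<in> FTA" | "M \<in> HOM" by blast
  then show "\<exists>E. valid_trans E \<and> trans_of E = M"
  proof cases
    case 1 then show ?thesis using ex_rel_desc unfolding REL_def by blast
  next
    case 2
    then obtain D where "valid_fta D" "M = Id_on (lang_of_fta D)"
      unfolding FTA_def using RECOG_iff by auto
    then show ?thesis by (intro exI[of _ "RestrDesc D"]) simp
  next
    case 3 then show ?thesis using ex_hom_desc unfolding HOM_def by blast
  qed
next
  assume "\<exists>E. valid_trans E \<and> trans_of E = M"
  then obtain E where E: "valid_trans E" "trans_of E = M" by blast
  show "M \<in> REL \<union> FTA \<union> HOM"
  proof (cases E)
    case (RelDesc A B R) then show ?thesis using E unfolding REL_def by auto
  next
    case (RestrDesc D) then show ?thesis using E RECOG_iff unfolding FTA_def by auto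
  next
    case (HomDesc A B H) then show ?thesis using E unfolding HOM_def by auto
  qed
qed

lemma Surface_iff_described: "U \<in> Surface \<longleftrightarrow> (\<exists>d. describes d U)"
proof
  assume "U \<in> Surface"
  then obtain Ms L where *: "U = compose Ms `` L" "Ms \<noteq> []" "set Ms \<subseteq> REL \<union> FTA \<union> HOM" "L \<in> RECOG"
    unfolding Surface_def compositions_def by auto
  obtain D where D: "valid_fta D" "lang_of_fta D = L" using * RECOG_iff by blast
  from *(3) have "\<exists>Es. map trans_of Es = Ms \<and> (\<forall>E \<in> set Es. valid_trans E)"
  proof (induction Ms)
    case (Cons M Ms)
    then obtain Es where "map trans_of Es = Ms" "\<forall>E \<in> set Es. valid_trans E" by auto
    moreover obtain E where "valid_trans E" "trans_of E = M" using Cons.prems trans_iff by auto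
    ultimately show ?case by (intro exI[of _ "E # Es"]) simp
  qed simp
  then obtain Es where Es: "map trans_of Es = Ms" "\<forall>E \<in> set Es. valid_trans E" by blast
  have "describes (SurfaceDesc D Es) U" using * D Es by auto
  then show "\<exists>d. describes d U" by blast
next
  assume "\<exists>d. describes d U"
  then obtain d where d: "describes d U" by blast
  obtain D Es where [simp]: "d = SurfaceDesc D Es" by (cases d)
  have "set (map trans_of Es) \<subseteq> REL \<union> FTA \<union> HOM" using d trans_iff by auto
  then have "compose (map trans_of Es) \<in> compositions (REL \<union> FTA \<union> HOM)"
    unfolding compositions_def using d
    by (intro CollectI exI[of _ "map trans_of Es"]) simp
  moreover have "lang_of_fta D \<in> RECOG" using d RECOG_iff by auto
  ultimately show "U \<in> Surface" using d unfolding Surface_def by auto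
qed


section \<open>Algorithms\<close>

text \<open>
  Algorithms are terms for partial recursive functions; \<open>computes f xs y\<close> says that \<open>f\<close>
  halts on the arguments \<open>xs\<close> with value \<open>y\<close>.
\<close>

datatype recf = Zero | Succ | Proj nat | Comp recf "recf list" | PrimRec recf recf | Mu recf

inductive computes :: "recf \<Rightarrow> nat list \<Rightarrow> nat \<Rightarrow> bool" where
  "computes Zero xs 0"
| "computes Succ [x] (Suc x)"
| "i < length xs \<Longrightarrow> computes (Proj i) xs (xs ! i)"
| "list_all2 (\<lambda>g y. computes g xs y) gs ys \<Longrightarrow> computes f ys z \<Longrightarrow> computes (Comp f gs) xs z"
| "computes f xs y \<Longrightarrow> computes (PrimRec f g) (0 # xs) y"
| "computes (PrimRec f g) (n # xs) y \<Longrightarrow> computes g (n # y # xs) z \<Longrightarrow>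
   computes (PrimRec f g) (Suc n # xs) z"
| "computes f (n # xs) 0 \<Longrightarrow> (\<And>i. i < n \<Longrightarrow> \<exists>y. computes f (i # xs) (Suc y)) \<Longrightarrow>
   computes (Mu f) xs n"

lemma computes_deterministic: "computes f xs y \<Longrightarrow> computes f xs z \<Longrightarrow> y = z"
proof (induction arbitrary: z rule: computes.induct)
  case (4 xs gs ys f z z')
  from "4.prems" obtain ys' where ys': "list_all2 (\<lambda>g y. computes g xs y) gs ys'" "computes f ys' z'"
    by (cases rule: computes.cases) auto
  have "ys = ys'"
    using "4.IH"(1) ys'(1) by (auto simp: list_all2_conv_all_nth intro!: nth_equalityI)
  then show ?case using "4.IH"(2) ys' by blast
next
  case (5 f xs y g)
  from "5.prems" show ?case by (cases rule: computes.cases) (auto dest: "5.IH")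
next
  case (6 f g n xs y z z')
  from "6.prems" obtain y' where "computes (PrimRec f g) (n # xs) y'" "computes g (n # y' # xs) z'"
    by (cases rule: computes.cases) auto
  then show ?case using "6.IH" by metis
next
  case (7 f n xs z)
  from "7.prems" have z: "computes f (z # xs) 0 \<and> (\<forall>i<z. \<exists>y. computes f (i # xs) (Suc y))"
    by (cases rule: computes.cases) auto
  have "\<not> z < n" using "7.IH"(2)[of z] z by (metis nat.distinct(1))
  moreover have "\<not> n < z" using "7.IH"(1) z by (metis nat.distinct(1))
  ultimately show ?case by simp
qed (erule computes.cases; simp)+


section \<open>Coding descriptions as natural numbers\<close>

primrec vtree_encode :: "nat vtree \<Rightarrow> nat" where
  "vtree_encode (Var i) = prod_encode (0, i)"
| "vtree_encode (VNode a vs) = prod_encode (Suc a, list_encode (map vtree_encode vs))"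

definition alph_encode :: "alph_desc \<Rightarrow> nat" where
  "alph_encode A = list_encode (map prod_encode A)"

fun fta_encode :: "fta_desc \<Rightarrow> nat" where
  "fta_encode (FtaDesc A Q F T) = list_encode
     [alph_encode A, list_encode Q, list_encode F,
      list_encode (map (\<lambda>((a, qs), q). list_encode [a, list_encode qs, q]) T)]"

fun trans_encode :: "trans_desc \<Rightarrow> nat" where
  "trans_encode (RelDesc A B R) = list_encode
     [0, alph_encode A, alph_encode B, list_encode (map (\<lambda>(a, k, b). list_encode [a, k, b]) R)]"
| "trans_encode (RestrDesc D) = list_encode [1, fta_encode D]"
| "trans_encode (HomDesc A B H) = list_encode
     [2, alph_encode A, alph_encode B,
      list_encode (map (\<lambda>((a, k), v). list_encode [a, k, vtree_encode v]) H)]"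

fun surface_encode :: "surface_desc \<Rightarrow> nat" where
  "surface_encode (SurfaceDesc D Ds) = prod_encode (fta_encode D, list_encode (map trans_encode Ds))"

end

theory Submission imports Defs begin

text \<open>
  Follow one root-to-node path of an output tree back through the homomorphisms, relabelings and
  restrictions: it comes from a path of the input tree, and the copies made by homomorphisms
  are harmless because the path enters only one of them, while for the others it matters only
  whether some relabeling of them passes the later restrictions, which is a regular property.
  So the set of path lengths occurring in the outputs of a tree \<open>t\<close> is computed by a finite
  automaton that walks down one path of \<open>t\<close>, adds a weight at every step and has regular
  look-ahead on the subtrees. The number of states is at most an iterated exponential in the
  description. Pumping in this automaton gives computable bounds such that \<open>U\<close> is infinite iff
  some input tree below the first bound has an output of height above the second one, and this
  is decided by exhaustive search.
\<close>

section \<open>Computable functions\<close>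

text \<open>Outputs lie over one finite alphabet, so \<open>U\<close> is finite iff the heights of
  its trees are bounded, and a single path witnesses that a tree is high. Computing forward is
  obstructed: after a copying homomorphism the set of images need not be recognizable, and a later
  relabeling may treat the copies differently. Inverse images avoid this, because "some relabeled
  tree has a path of length \<open>n\<close>" is existential in both the tree and the path, so one
  nondeterministic walk can guess both; the rest of the relabeled tree enters only through the
  existence of subtrees with suitable look-ahead states.

  The algorithm never builds the path automaton. Only a number \<open>N\<close> bounding its states,
  weights and stop values enters the bounds, so \<open>path_recognizable\<close> merely asserts
  existence and its closure lemmas may use arbitrary sets. What must be shown computable is
  arithmetic on the bounds, the enumeration of trees of bounded height, and the application of coded
  transformations to a given tree.\<close>

class encodable =
  fixes enc :: "'a \<Rightarrow> nat"

instantiation nat :: encodable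
begin
definition enc_nat :: "nat \<Rightarrow> nat" where [simp]: "enc_nat n = n"
instance ..
end

instantiation bool :: encodable
begin
definition enc_bool :: "bool \<Rightarrow> nat" where [simp]: "enc_bool b = of_bool b"
instance ..
end

instantiation prod :: (encodable, encodable) encodable
begin
definition enc_prod :: "'a \<times> 'b \<Rightarrow> nat" where
  [simp]: "enc_prod p = prod_encode (enc (fst p), enc (snd p))"
instance ..
end

instantiation list :: (encodable) encodable
begin
definition enc_list :: "'a list \<Rightarrow> nat" where [simp]: "enc_list xs = list_encode (map enc xs)"
instance ..
end

instantiation tree :: (encodable) encodable
begin
primrec enc_tree :: "'a tree \<Rightarrow> nat" where
  "enc_tree (Node a ts) = prod_encode (enc a, list_encode (map enc_tree ts))"
instance ..
end

text \<open>Tuples are coded into one number, so unary functions suffice. The rules collected below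
  concern terms that depend on a context \<open>x\<close>. A bound variable is handled by pairing it
  with the context, as in premises of the form
  \<open>computable (\<lambda>z. F (fst z) (snd z))\<close>, so that proofs follow the syntax of the
  term.\<close>

definition computable :: "('a::encodable \<Rightarrow> 'b::encodable) \<Rightarrow> bool" where
  "computable f \<longleftrightarrow> (\<exists>p. \<forall>x. computes p [enc x] (enc (f x)))"

named_theorems computable_intros

section \<open>Arithmetic and Cantor pairing as recursive functions\<close>

lemma computes_Proj: "i < length xs \<Longrightarrow> y = xs ! i \<Longrightarrow> computes (Proj i) xs y"
  by (simp add: computes.intros(3))

lemma computes_Comp1: "computes g xs y \<Longrightarrow> computes f [y] z \<Longrightarrow> computes (Comp f [g]) xs z"
  by (rule computes.intros(4)[of xs "[g]" "[y]"]) auto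

lemma computes_Comp2:
  "computes g xs y \<Longrightarrow> computes g' xs y' \<Longrightarrow> computes f [y, y'] z \<Longrightarrow> computes (Comp f [g, g']) xs z"
  by (rule computes.intros(4)[of xs "[g, g']" "[y, y']"]) auto

lemma computes_const: "\<exists>p. \<forall>xs. computes p xs n"
proof (induction n)
  case 0
  show ?case by (intro exI[of _ Zero] allI computes.intros)
next
  case (Suc n)
  then obtain p where "\<forall>xs. computes p xs n" by blast
  then show ?case by (intro exI[of _ "Comp Succ [p]"] allI computes_Comp1[of p _ n] computes.intros) simp
qed

lemma computes_PrimRec:
  assumes "computes f xs (F 0)" "\<And>n. computes g (n # F n # xs) (F (Suc n))"
  shows "computes (PrimRec f g) (n # xs) (F n)"
  by (induction n) (auto intro: assms computes.intros)

definition add_rec :: recf where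
  "add_rec = PrimRec (Proj 0) (Comp Succ [Proj 1])"

lemma computes_add_rec: "computes add_rec [m, n] (m + n)"
  unfolding add_rec_def
proof (rule computes_PrimRec[where F = "\<lambda>m. m + n"])
  show "computes (Proj 0) [n] (0 + n)" by (simp add: computes_Proj)
  show "computes (Comp Succ [Proj 1]) [m, m + n, n] (Suc m + n)" for m
    by (rule computes_Comp1[OF computes_Proj[OF _ refl]]) (auto intro: computes.intros)
qed

text \<open>\<open>PrimRec\<close> recurses on its first argument, so the subtrahend comes first and
  counts the applications of the predecessor.\<close>

definition monus_rec :: recf where
  "monus_rec = PrimRec (Proj 0) (Comp (PrimRec Zero (Proj 0)) [Proj 1])"

lemma computes_monus_rec: "computes monus_rec [m, n] (n - m)"
proof -
  have pred: "computes (PrimRec Zero (Proj 0)) [k] (k - 1)" for k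
    by (rule computes_PrimRec[where F = "\<lambda>k. k - 1"]) (auto intro: computes_Proj computes.intros)
  show ?thesis
    unfolding monus_rec_def
  proof (rule computes_PrimRec[where F = "\<lambda>m. n - m"])
    show "computes (Proj 0) [n] (n - 0)" by (simp add: computes_Proj)
    show "computes (Comp (PrimRec Zero (Proj 0)) [Proj 1]) [m, n - m, n] (n - Suc m)" for m
      using pred[of "n - m"] by (intro computes_Comp1[OF computes_Proj[OF _ refl]]) simp_all
  qed
qed

definition triangle_rec :: recf where
  "triangle_rec = PrimRec Zero (Comp add_rec [Proj 1, Comp Succ [Proj 0]])"

lemma computes_triangle_rec: "computes triangle_rec [n] (triangle n)"
  unfolding triangle_rec_def
proof (rule computes_PrimRec[where F = triangle])
  show "computes Zero [] (triangle 0)" using computes.intros(1) by simp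
  show "computes (Comp add_rec [Proj 1, Comp Succ [Proj 0]]) [n, triangle n] (triangle (Suc n))" for n
    unfolding triangle_Suc
    by (rule computes_Comp2 computes_Comp1 computes_add_rec computes.intros(2) computes_Proj | simp)+
qed

definition pair_rec :: recf where
  "pair_rec = Comp add_rec [Comp triangle_rec [add_rec], Proj 0]"

lemma computes_pair_rec: "computes pair_rec [m, n] (prod_encode (m, n))"
  unfolding pair_rec_def prod_encode_def split
  by (rule computes_Comp2 computes_Comp1 computes_add_rec computes_triangle_rec computes_Proj | simp)+

text \<open>Since \<open>prod_encode (m, n) = triangle (m + n) + m\<close>, the sum
  \<open>m + n\<close> is the least \<open>s\<close> with
  \<open>prod_encode (m, n) < triangle (Suc s)\<close>. Both projections then follow by subtraction.
  This is the only unbounded search in the whole procedure.\<close>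

definition diagonal_rec :: recf where
  "diagonal_rec = Mu (Comp monus_rec [Comp triangle_rec [Comp Succ [Proj 0]], Comp Succ [Proj 1]])"

lemma computes_diagonal_rec: "computes diagonal_rec [prod_encode (m, n)] (m + n)"
proof -
  have test: "computes (Comp monus_rec [Comp triangle_rec [Comp Succ [Proj 0]], Comp Succ [Proj 1]])
      [s, p] (Suc p - triangle (Suc s))" for s p
    by (rule computes_Comp2 computes_Comp1 computes_monus_rec computes_triangle_rec
        computes.intros(2) computes_Proj | simp)+
  have mono: "triangle i \<le> triangle j" if "i \<le> j" for i j
    using that by (induction rule: dec_induct) (auto simp del: triangle_Suc simp: triangle_Suc)
  show ?thesis
    unfolding diagonal_rec_def
  proof (rule computes.intros(7))
    show "computes (Comp monus_rec [Comp triangle_rec [Comp Succ [Proj 0]], Comp Succ [Proj 1]])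
      [m + n, prod_encode (m, n)] 0"
      using test[of "m + n" "prod_encode (m, n)"] by (simp add: prod_encode_def)
    fix i assume "i < m + n"
    then have "triangle (Suc i) \<le> prod_encode (m, n)"
      using mono[of "Suc i" "m + n"] by (simp add: prod_encode_def)
    then show "\<exists>y. computes (Comp monus_rec [Comp triangle_rec [Comp Succ [Proj 0]], Comp Succ [Proj 1]])
      [i, prod_encode (m, n)] (Suc y)"
      using test[of i "prod_encode (m, n)"] by (auto simp: Suc_diff_le simp del: triangle_Suc)
  qed
qed

definition fst_rec :: recf where
  "fst_rec = Comp monus_rec [Comp triangle_rec [diagonal_rec], Proj 0]"

lemma computes_fst_rec: "computes fst_rec [prod_encode (m, n)] m"
proof -
  have "computes fst_rec [prod_encode (m, n)] (prod_encode (m, n) - triangle (m + n))"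
    unfolding fst_rec_def
    by (rule computes_Comp2[OF computes_Comp1[OF computes_diagonal_rec computes_triangle_rec]
        computes_Proj[OF _ refl]])
      (simp_all add: computes_monus_rec)
  then show ?thesis by (simp add: prod_encode_def)
qed

definition snd_rec :: recf where
  "snd_rec = Comp monus_rec [fst_rec, diagonal_rec]"

lemma computes_snd_rec: "computes snd_rec [prod_encode (m, n)] n"
  unfolding snd_rec_def
  using computes_Comp2[OF computes_fst_rec computes_diagonal_rec computes_monus_rec] by simp

section \<open>Closure properties of computable functions\<close>

lemma computable_ident [computable_intros]: "computable (\<lambda>x. x)"
  unfolding computable_def by (intro exI[of _ "Proj 0"] allI computes_Proj) simp_all

lemma computable_const [computable_intros]: "computable (\<lambda>x. c)"
  unfolding computable_def using computes_const[of "enc c"] by blast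

text \<open>Computability depends on codes only. Thus \<open>enc\<close>, \<open>of_bool\<close>,
  \<open>list_decode\<close> and \<open>prod_decode\<close> come for free: they are the identity on
  codes.\<close>

lemma computable_recode:
  assumes "computable f" "\<And>x. enc (g x) = enc (f x)"
  shows "computable g"
  using assms by (simp add: computable_def)

lemma computable_compose:
  assumes "computable f" "computable g"
  shows "computable (\<lambda>x. f (g x))"
  using assms computes_Comp1 unfolding computable_def by metis

lemma computable_binary:
  assumes "\<And>x. computes p [enc (f x), enc (g x)] (enc (h x))" "computable f" "computable g"
  shows "computable h"
proof -
  obtain pf pg where "\<And>x. computes pf [enc x] (enc (f x))" "\<And>x. computes pg [enc x] (enc (g x))"
    using assms(2,3) unfolding computable_def by blast
  then have "computes (Comp p [pf, pg]) [enc x] (enc (h x))" for x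
    using assms(1) computes_Comp2 by blast
  then show ?thesis unfolding computable_def by blast
qed

lemma computable_Pair [computable_intros]:
  "computable f \<Longrightarrow> computable g \<Longrightarrow> computable (\<lambda>x. (f x, g x))"
  by (rule computable_binary[of pair_rec f g]) (auto simp: computes_pair_rec)

lemma computable_plus [computable_intros]:
  fixes f g :: "'a::encodable \<Rightarrow> nat"
  shows "computable f \<Longrightarrow> computable g \<Longrightarrow> computable (\<lambda>x. f x + g x)"
  by (rule computable_binary[of add_rec f g]) (auto simp: computes_add_rec)

lemma computable_minus [computable_intros]:
  fixes f g :: "'a::encodable \<Rightarrow> nat"
  assumes "computable f" "computable g"
  shows "computable (\<lambda>x. f x - g x)"
  by (rule computable_binary[of monus_rec g f]) (auto simp: computes_monus_rec assms)

lemma computable_fst [computable_intros]: "computable f \<Longrightarrow> computable (\<lambda>x. fst (f x))"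
  by (rule computable_compose[of fst]) (auto simp: computable_def intro: computes_fst_rec)

lemma computable_snd [computable_intros]: "computable f \<Longrightarrow> computable (\<lambda>x. snd (f x))"
  by (rule computable_compose[of snd]) (auto simp: computable_def intro: computes_snd_rec)

lemma computable_Suc [computable_intros]: "computable f \<Longrightarrow> computable (\<lambda>x. Suc (f x))"
  by (rule computable_compose[of Suc]) (auto simp: computable_def intro: computes.intros)

lemma computable_enc [computable_intros]: "computable f \<Longrightarrow> computable (\<lambda>x. enc (f x))"
  by (erule computable_recode) simp

lemma computable_of_bool [computable_intros]: "computable f \<Longrightarrow> computable (\<lambda>x. of_bool (f x) :: nat)"
  by (erule computable_recode) simp

lemma computable_list_decode [computable_intros]:
  "computable f \<Longrightarrow> computable (\<lambda>x. list_decode (f x))"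
  by (erule computable_recode) (simp add: map_idI)

lemma computable_prod_decode [computable_intros]:
  "computable f \<Longrightarrow> computable (\<lambda>x. prod_decode (f x))"
  by (erule computable_recode) simp

lemma computable_prod_encode [computable_intros]:
  "computable f \<Longrightarrow> computable (\<lambda>x. prod_encode (f x))"
  by (erule computable_recode) simp

lemma computable_Node [computable_intros]:
  "computable f \<Longrightarrow> computable g \<Longrightarrow> computable (\<lambda>x. Node (f x) (g x))"
  by (rule computable_recode[OF computable_Pair[of f g]]) simp_all

text \<open>The one loop construct to which conditionals, folds and tree recursion are reduced
  below. \<open>PrimRec\<close> passes counter, accumulator and context in this order, hence
  \<open>Proj 2\<close> and \<open>Proj 1\<close> in the step.\<close>

lemma computable_funpow [computable_intros]:
  fixes F :: "'a::encodable \<Rightarrow> 'b::encodable \<Rightarrow> 'b"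
  assumes F: "computable (\<lambda>z. F (fst z) (snd z))" and n: "computable n" and s: "computable s"
  shows "computable (\<lambda>x. (F x ^^ n x) (s x))"
proof -
  obtain pF where pF: "\<And>x y. computes pF [prod_encode (enc x, enc y)] (enc (F x y))"
    using F unfolding computable_def by auto
  obtain ps where ps: "\<And>x. computes ps [enc x] (enc (s x))"
    using s unfolding computable_def by auto
  let ?p = "PrimRec ps (Comp pF [Comp pair_rec [Proj 2, Proj 1]])"
  have "computes ?p [k, enc x] (enc ((F x ^^ k) (s x)))" for k x
  proof (rule computes_PrimRec[where F = "\<lambda>k. enc ((F x ^^ k) (s x))"])
    show "computes ps [enc x] (enc ((F x ^^ 0) (s x)))" using ps by simp
    fix k
    show "computes (Comp pF [Comp pair_rec [Proj 2, Proj 1]]) [k, enc ((F x ^^ k) (s x)), enc x]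
       (enc ((F x ^^ Suc k) (s x)))"
      by (rule computes_Comp1[OF computes_Comp2[OF _ _ computes_pair_rec]])
        (auto intro!: computes_Proj pF)
  qed
  note run = this
  show ?thesis
    by (rule computable_binary[where p = ?p and f = n and g = "\<lambda>x. x"]) (use run n computable_ident in auto)
qed

lemma computable_times [computable_intros]:
  fixes f g :: "'a::encodable \<Rightarrow> nat"
  assumes "computable f" "computable g"
  shows "computable (\<lambda>x. f x * g x)"
proof -
  have eq: "f x * g x = (((+) (g x)) ^^ f x) 0" for x
  proof -
    have "n * g x = (((+) (g x)) ^^ n) 0" for n by (induction n) simp_all
    then show ?thesis .
  qed
  show ?thesis unfolding eq by (intro computable_intros computable_compose[OF assms(2)] assms)
qed

lemma computable_power [computable_intros]:
  fixes f g :: "'a::encodable \<Rightarrow> nat"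
  assumes "computable f" "computable g"
  shows "computable (\<lambda>x. f x ^ g x)"
proof -
  have eq: "f x ^ g x = (((*) (f x)) ^^ g x) 1" for x
  proof -
    have "f x ^ n = (((*) (f x)) ^^ n) 1" for n by (induction n) simp_all
    then show ?thesis .
  qed
  show ?thesis unfolding eq by (intro computable_intros computable_compose[OF assms(1)] assms)
qed

text \<open>A conditional is a constant function iterated once or not at all.\<close>

lemma computable_If [computable_intros]:
  assumes "computable b" "computable f" "computable g"
  shows "computable (\<lambda>x. if b x then f x else g x)"
proof -
  have eq: "(if b x then f x else g x) = ((\<lambda>_. f x) ^^ of_bool (b x)) (g x)" for x by simp
  show ?thesis unfolding eq by (intro computable_intros computable_compose[OF assms(2)] assms)
qed

lemma computable_Not [computable_intros]:
  assumes "computable b" shows "computable (\<lambda>x. \<not> b x)"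
proof -
  have eq: "(\<not> b x) = (if b x then False else True)" for x by simp
  show ?thesis unfolding eq by (intro computable_intros assms)
qed

lemma computable_conj [computable_intros]:
  assumes "computable b" "computable c" shows "computable (\<lambda>x. b x \<and> c x)"
proof -
  have eq: "(b x \<and> c x) = (if b x then c x else False)" for x by simp
  show ?thesis unfolding eq by (intro computable_intros assms)
qed

lemma computable_eq_0:
  fixes f :: "'a::encodable \<Rightarrow> nat"
  assumes "computable f"
  shows "computable (\<lambda>x. f x = 0)"
proof -
  have eq: "(f x = 0) = ((\<lambda>_. False) ^^ f x) True" for x by (cases "f x") simp_all
  show ?thesis unfolding eq by (intro computable_intros assms)
qed

lemma computable_less [computable_intros]:
  fixes f g :: "'a::encodable \<Rightarrow> nat"
  assumes "computable f" "computable g"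
  shows "computable (\<lambda>x. f x < g x)"
proof -
  have eq: "(f x < g x) = (\<not> (g x - f x = 0))" for x by auto
  show ?thesis unfolding eq by (intro computable_intros computable_eq_0 assms)
qed

lemma computable_eq [computable_intros]:
  fixes f g :: "'a::encodable \<Rightarrow> nat"
  assumes "computable f" "computable g"
  shows "computable (\<lambda>x. f x = g x)"
proof -
  have eq: "(\<lambda>x. f x = g x) = (\<lambda>x. f x - g x + (g x - f x) = 0)" by auto
  show ?thesis by (subst eq) (intro computable_intros computable_eq_0 assms)
qed

lemma computable_max [computable_intros]:
  fixes f g :: "'a::encodable \<Rightarrow> nat"
  assumes "computable f" "computable g"
  shows "computable (\<lambda>x. max (f x) (g x))"
proof -
  have eq: "max (f x) (g x) = f x + (g x - f x)" for x by auto
  show ?thesis unfolding eq by (intro computable_intros assms)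
qed

section \<open>Computable operations on lists\<close>

lemma computable_Cons [computable_intros]:
  "computable f \<Longrightarrow> computable g \<Longrightarrow> computable (\<lambda>x. f x # g x)"
  by (rule computable_recode[OF computable_Suc[OF computable_enc[OF computable_Pair[of f g]]]]) simp_all

lemma computable_eq_Nil [computable_intros]:
  assumes "computable f" shows "computable (\<lambda>x. f x = [])"
proof -
  have eq: "(f x = []) = (enc (f x) = 0)" for x by (cases "f x") simp_all
  show ?thesis unfolding eq by (intro computable_intros assms)
qed

text \<open>The empty list has code 0, whose predecessor is again 0; this equation makes the code of
  \<open>tl []\<close> come out as 0 in the next lemma.\<close>

lemma prod_decode_0: "prod_decode 0 = (0, 0)"
proof -
  have "prod_encode (0, 0) = 0" by (simp add: prod_encode_def)
  then show ?thesis by (metis prod_encode_inverse)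
qed

lemma computable_tl [computable_intros]:
  assumes "computable f" shows "computable (\<lambda>x. tl (f x))"
proof (rule computable_recode)
  show "computable (\<lambda>x. snd (prod_decode (enc (f x) - 1)))" by (intro computable_intros assms)
  show "enc (tl (f x)) = enc (snd (prod_decode (enc (f x) - 1)))" for x
    by (cases "f x") (simp_all add: prod_decode_0)
qed

text \<open>\<open>hd []\<close> is unspecified, but as a constant it is computable.\<close>

lemma computable_hd [computable_intros]:
  fixes f :: "'a::encodable \<Rightarrow> 'b::encodable list"
  assumes "computable f" shows "computable (\<lambda>x. hd (f x))"
proof (rule computable_recode)
  show "computable (\<lambda>x. if f x = [] then enc (hd [] :: 'b) else fst (prod_decode (enc (f x) - 1)))"
    by (intro computable_intros assms)
  show "enc (hd (f x)) = enc (if f x = [] then enc (hd [] :: 'b) else fst (prod_decode (enc (f x) - 1)))" for x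
    by (cases "f x") simp_all
qed

lemma computable_drop [computable_intros]:
  fixes f :: "'a::encodable \<Rightarrow> 'b::encodable list"
  assumes "computable n" "computable f" shows "computable (\<lambda>x. drop (n x) (f x))"
proof -
  have eq: "drop k xs = (tl ^^ k) xs" for k and xs :: "'b list"
    by (induction k arbitrary: xs) (simp_all add: drop_Suc tl_drop drop_tl[symmetric] del: funpow.simps add: funpow_Suc_right)
  show ?thesis unfolding eq by (intro computable_intros assms)
qed

lemma length_le_list_encode: "length ns \<le> list_encode ns"
  by (induction ns) (simp_all add: le_prod_encode_2 le_trans)

text \<open>The length of a list is not yet available as a loop count. Its code is at least as
  large, and iterating further on an exhausted list changes nothing.\<close>

lemma computable_fold [computable_intros]:
  fixes F :: "'a::encodable \<Rightarrow> 'b::encodable \<Rightarrow> 'c::encodable \<Rightarrow> 'c"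
  assumes F: "computable (\<lambda>z. F (fst z) (fst (snd z)) (snd (snd z)))"
    and xs: "computable xs" and s: "computable s"
  shows "computable (\<lambda>x. fold (F x) (xs x) (s x))"
proof -
  define step where "step x z = (if fst z = [] then z else (tl (fst z), F x (hd (fst z)) (snd z)))" for x z
  have fold: "snd ((step x ^^ n) (ys, c)) = fold (F x) ys c" if "length ys \<le> n" for x n ys c
    using that
  proof (induction n arbitrary: ys c)
    case (Suc n)
    then show ?case
    proof (cases ys)
      case Nil
      have "(step x ^^ n) ([], c) = ([], c)" for n by (induction n) (simp_all add: step_def)
      with Nil show ?thesis by (metis fold_Nil id_apply snd_conv)
    next
      case (Cons y ys')
      then show ?thesis using Suc by (simp add: step_def funpow_Suc_right del: funpow.simps)
    qed
  qed simp
  have "length ys \<le> enc ys" for ys :: "'b list"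
    using length_le_list_encode[of "map enc ys"] by simp
  then have eq: "fold (F x) (xs x) (s x) = snd ((step x ^^ enc (xs x)) (xs x, s x))" for x
    using fold by metis
  have "computable (\<lambda>z::'a \<times> 'b list \<times> 'c. F (fst z) (hd (fst (snd z))) (snd (snd z)))"
    using computable_compose[OF F, of "\<lambda>z::'a \<times> 'b list \<times> 'c. (fst z, hd (fst (snd z)), snd (snd z))"]
    by (simp add: computable_intros)
  then show ?thesis
    unfolding eq unfolding step_def by (intro computable_intros xs s)
qed

lemma computable_rev [computable_intros]:
  assumes "computable xs" shows "computable (\<lambda>x. rev (xs x))"
  unfolding rev_conv_fold by (intro computable_intros assms)

lemma computable_append [computable_intros]:
  fixes xs ys :: "'a::encodable \<Rightarrow> 'b::encodable list"
  assumes "computable xs" "computable ys" shows "computable (\<lambda>x. xs x @ ys x)"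
proof -
  have "fold Cons ws vs = rev ws @ vs" for ws vs :: "'b list"
    by (induction ws arbitrary: vs) simp_all
  then have eq: "us @ vs = fold Cons (rev us) vs" for us vs :: "'b list" by simp
  show ?thesis unfolding eq by (intro computable_intros assms)
qed

lemma computable_map [computable_intros]:
  fixes F :: "'a::encodable \<Rightarrow> 'b::encodable \<Rightarrow> 'c::encodable"
  assumes F: "computable (\<lambda>z. F (fst z) (snd z))" and xs: "computable xs"
  shows "computable (\<lambda>x. map (F x) (xs x))"
proof -
  have "fold (\<lambda>y zs. zs @ [F x y]) ys zs = zs @ map (F x) ys" for x ys zs
    by (induction ys arbitrary: zs) simp_all
  then have eq: "map (F x) ys = fold (\<lambda>y zs. zs @ [F x y]) ys []" for x ys by simp
  have "computable (\<lambda>z::'a \<times> 'b \<times> 'c list. F (fst z) (fst (snd z)))"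
    using computable_compose[OF F, of "\<lambda>z::'a \<times> 'b \<times> 'c list. (fst z, fst (snd z))"]
    by (simp add: computable_intros)
  then show ?thesis unfolding eq by (intro computable_intros xs)
qed

lemma computable_filter [computable_intros]:
  fixes P :: "'a::encodable \<Rightarrow> 'b::encodable \<Rightarrow> bool"
  assumes P: "computable (\<lambda>z. P (fst z) (snd z))" and xs: "computable xs"
  shows "computable (\<lambda>x. filter (P x) (xs x))"
proof -
  have "fold (\<lambda>y zs. if P x y then zs @ [y] else zs) ys zs = zs @ filter (P x) ys" for x ys zs
    by (induction ys arbitrary: zs) simp_all
  then have eq: "filter (P x) ys = fold (\<lambda>y zs. if P x y then zs @ [y] else zs) ys []" for x ys by simp
  have "computable (\<lambda>z::'a \<times> 'b \<times> 'b list. P (fst z) (fst (snd z)))"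
    using computable_compose[OF P, of "\<lambda>z::'a \<times> 'b \<times> 'b list. (fst z, fst (snd z))"]
    by (simp add: computable_intros)
  then show ?thesis unfolding eq by (intro computable_intros xs)
qed

lemma computable_concat [computable_intros]:
  fixes xss :: "'a::encodable \<Rightarrow> 'b::encodable list list"
  assumes "computable xss" shows "computable (\<lambda>x. concat (xss x))"
proof -
  have "fold (\<lambda>ys zs. zs @ ys) yss zs = zs @ concat yss" for yss :: "'b list list" and zs :: "'b list"
    by (induction yss arbitrary: zs) simp_all
  then have eq: "concat yss = fold (\<lambda>ys zs. zs @ ys) yss []" for yss :: "'b list list" by simp
  show ?thesis unfolding eq by (intro computable_intros assms)
qed

lemma computable_length [computable_intros]:
  fixes xs :: "'a::encodable \<Rightarrow> 'b::encodable list"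
  assumes "computable xs" shows "computable (\<lambda>x. length (xs x))"
proof -
  have "fold (\<lambda>_. Suc) ys n = n + length ys" for ys :: "'b list" and n
    by (induction ys arbitrary: n) simp_all
  then have eq: "length ys = fold (\<lambda>_. Suc) ys 0" for ys :: "'b list" by simp
  show ?thesis unfolding eq by (intro computable_intros assms)
qed

lemma computable_list_all [computable_intros]:
  fixes P :: "'a::encodable \<Rightarrow> 'b::encodable \<Rightarrow> bool"
  assumes P: "computable (\<lambda>z. P (fst z) (snd z))" and xs: "computable xs"
  shows "computable (\<lambda>x. list_all (P x) (xs x))"
proof -
  have eq: "list_all (P x) ys = (filter (\<lambda>y. \<not> P x y) ys = [])" for x ys
    by (induction ys) simp_all
  show ?thesis unfolding eq by (intro computable_intros P xs)
qed

lemma computable_list_ex [computable_intros]: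
  fixes P :: "'a::encodable \<Rightarrow> 'b::encodable \<Rightarrow> bool"
  assumes P: "computable (\<lambda>z. P (fst z) (snd z))" and xs: "computable xs"
  shows "computable (\<lambda>x. list_ex (P x) (xs x))"
proof -
  have eq: "list_ex (P x) ys = (\<not> list_all (\<lambda>y. \<not> P x y) ys)" for x ys
    by (induction ys) simp_all
  show ?thesis unfolding eq by (intro computable_intros P xs)
qed

lemma computable_in_list [computable_intros]:
  fixes f :: "'a::encodable \<Rightarrow> nat"
  assumes "computable f" "computable xs" shows "computable (\<lambda>x. f x \<in> set (xs x))"
proof -
  have eq: "n \<in> set ns \<longleftrightarrow> list_ex (\<lambda>m. m = n) ns" for n :: nat and ns by (simp add: list_ex_iff)
  show ?thesis unfolding eq by (intro computable_intros computable_compose[OF assms(1)] assms)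
qed

lemma computable_list_encode [computable_intros]:
  fixes f :: "'a::encodable \<Rightarrow> nat list"
  shows "computable f \<Longrightarrow> computable (\<lambda>x. list_encode (f x))"
  by (erule computable_recode) (simp add: map_idI)

lemma computable_foldr [computable_intros]:
  fixes F :: "'a::encodable \<Rightarrow> 'b::encodable \<Rightarrow> 'c::encodable \<Rightarrow> 'c"
  assumes "computable (\<lambda>z. F (fst z) (fst (snd z)) (snd (snd z)))" "computable xs" "computable s"
  shows "computable (\<lambda>x. foldr (F x) (xs x) (s x))"
  unfolding foldr_conv_fold by (intro computable_intros assms)

lemma computable_product_lists [computable_intros]:
  fixes xss :: "'a::encodable \<Rightarrow> 'b::encodable list list"
  assumes "computable xss" shows "computable (\<lambda>x. product_lists (xss x))"
proof -
  have eq: "product_lists yss = foldr (\<lambda>ys zss. concat (map (\<lambda>y. map (Cons y) zss) ys)) yss [[]]"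
    for yss :: "'b list list" by (induction yss) simp_all
  show ?thesis unfolding eq by (intro computable_intros assms)
qed

lemma computable_n_lists [computable_intros]:
  fixes xs :: "'a::encodable \<Rightarrow> 'b::encodable list"
  assumes "computable n" "computable xs" shows "computable (\<lambda>x. List.n_lists (n x) (xs x))"
proof -
  have eq: "List.n_lists k ys = ((\<lambda>zss. concat (map (\<lambda>zs. map (\<lambda>y. y # zs) ys) zss)) ^^ k) [[]]"
    for k and ys :: "'b list" by (induction k) simp_all
  have "computable (\<lambda>z::('a \<times> 'b list list) \<times> 'b list. xs (fst (fst z)))"
    by (rule computable_compose[OF assms(2)]) (intro computable_intros)
  then show ?thesis unfolding eq by (intro computable_intros assms)
qed

subsection \<open>Recursion on coded trees\<close>

lemma less_list_encode: "n \<in> set ns \<Longrightarrow> n < list_encode ns"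
proof (induction ns)
  case (Cons m ns)
  then show ?case
    using le_prod_encode_1[of m "list_encode ns"] le_prod_encode_2[of "list_encode ns" m]
    by (auto simp: less_Suc_eq_le)
qed simp

text \<open>
  Both \<open>enc\<close> on trees and \<open>vtree_encode\<close> code a node as a pair of a label and a list of children,
  so one recursion scheme serves for trees, and for variable trees with label 0 for variables
  (whose second component is then no list of children, and the recursive results are ignored).
\<close>

function crec :: "(nat \<Rightarrow> 'b list \<Rightarrow> 'b) \<Rightarrow> nat \<Rightarrow> 'b" where
  "crec g n = g n (map (crec g) (list_decode (snd (prod_decode n))))"
  by auto
termination
proof (relation "measure snd")
  fix g :: "nat \<Rightarrow> 'b list \<Rightarrow> 'b" and n m
  assume "m \<in> set (list_decode (snd (prod_decode n)))"
  then have "m < snd (prod_decode n)" using less_list_encode by fastforce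
  also have "\<dots> \<le> n" using le_prod_encode_2[of "snd (prod_decode n)" "fst (prod_decode n)"] by simp
  finally show "((g, m), g, n) \<in> measure snd" by simp
qed simp

declare crec.simps [simp del] list_encode.simps [simp del]

text \<open>Course-of-values recursion: the loop extends the table of values at
  \<open>0, ..., k - 1\<close> by the value at \<open>k\<close>. Codes of children are smaller than
  the code of their node, so their values are already in the table.\<close>

lemma computable_crec [computable_intros]:
  fixes F :: "'a::encodable \<Rightarrow> nat \<Rightarrow> 'b::encodable list \<Rightarrow> 'b"
  assumes F: "computable (\<lambda>z. F (fst z) (fst (snd z)) (snd (snd z)))" and n: "computable n"
  shows "computable (\<lambda>x. crec (F x) (n x))"
proof -
  define step where "step x vs = vs @
    [F x (length vs) (map (\<lambda>m. hd (drop m vs)) (list_decode (snd (prod_decode (length vs)))))]" for x vs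
  have steps: "(step x ^^ k) [] = map (crec (F x)) [0..<k]" for x k
  proof (induction k)
    case (Suc k)
    have "m < k" if "m \<in> set (list_decode (snd (prod_decode k)))" for m
      using that less_list_encode[OF that] le_prod_encode_2[of "snd (prod_decode k)" "fst (prod_decode k)"]
      by simp
    then have "map (\<lambda>m. hd (drop m (map (crec (F x)) [0..<k]))) (list_decode (snd (prod_decode k))) =
        map (crec (F x)) (list_decode (snd (prod_decode k)))"
      by (intro map_cong refl) (simp add: hd_drop_conv_nth)
    then have "step x (map (crec (F x)) [0..<k]) = map (crec (F x)) [0..<Suc k]"
      by (simp add: step_def crec.simps[of _ k] del: map_eq_conv)
    with Suc show ?case by simp
  qed simp
  have eq: "crec (F x) (n x) = hd (drop (n x) ((step x ^^ Suc (n x)) []))" for x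
    unfolding steps by (simp add: hd_drop_conv_nth del: upt_Suc)
  let ?g = "\<lambda>z::'a \<times> 'b list. (fst z, length (snd z),
    map (\<lambda>m. hd (drop m (snd z))) (list_decode (snd (prod_decode (length (snd z))))))"
  have "computable ?g" by (intro computable_intros)
  from computable_compose[OF F this]
  show ?thesis unfolding eq unfolding step_def by (intro computable_intros n) simp
qed

lemma crec_enc:
  "crec g (enc (Node a ts)) = g (enc (Node a ts)) (map (\<lambda>t. crec g (enc t)) ts)"
  by (simp add: crec.simps[of g "prod_encode _"] comp_def)

section \<open>The decision procedure\<close>

primrec height :: "'a tree \<Rightarrow> nat" where
  "height (Node a ts) = foldr (\<lambda>h. max (Suc h)) (map height ts) 0"

lemma height_le_iff: "height (Node a ts) \<le> n \<longleftrightarrow> (\<forall>t \<in> set ts. height t < n)"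
  by (induction ts) auto

lemma computable_height [computable_intros]:
  fixes t :: "'a::encodable \<Rightarrow> nat tree"
  assumes "computable t" shows "computable (\<lambda>x. height (t x))"
proof -
  have eq: "height s = crec (\<lambda>_ hs. foldr (\<lambda>h. max (Suc h)) hs 0) (enc s)" for s :: "nat tree"
  proof (induction s)
    case (Node a ts)
    then show ?case unfolding crec_enc by (simp cong: map_cong)
  qed
  show ?thesis unfolding eq by (intro computable_intros assms)
qed

section \<open>Evaluating coded automata and transformations on trees\<close>

definition item :: "nat \<Rightarrow> nat \<Rightarrow> nat" where
  "item i n = hd (drop i (list_decode n))"

lemma computable_item [computable_intros]: "computable f \<Longrightarrow> computable (\<lambda>x. item i (f x))"
  unfolding item_def by (intro computable_intros)

definition tree_test :: "nat \<Rightarrow> nat tree \<Rightarrow> bool" where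
  "tree_test A t = crec (\<lambda>n bs. list_all (\<lambda>b. b) bs \<and>
     prod_encode (fst (prod_decode n), length bs) \<in> set (list_decode A)) (enc t)"

lemma computable_tree_test [computable_intros]:
  assumes "computable A" "computable t" shows "computable (\<lambda>x. tree_test (A x) (t x))"
  unfolding tree_test_def by (intro computable_intros assms computable_compose[OF assms(1)])

definition lookup :: "nat \<Rightarrow> nat \<Rightarrow> nat \<Rightarrow> nat" where
  "lookup T k l = item 2 (hd (filter (\<lambda>e. item 0 e = k \<and> item 1 e = l) (list_decode T)))"

lemma computable_lookup [computable_intros]:
  assumes "computable T" "computable k" "computable l"
  shows "computable (\<lambda>x. lookup (T x) (k x) (l x))"
  unfolding lookup_def
  by (intro computable_intros assms computable_compose[OF assms(2)] computable_compose[OF assms(3)])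


lemma Node_in_trees_iff: "Node a ts \<in> trees Sg \<longleftrightarrow> a \<in> Sg (length ts) \<and> set ts \<subseteq> trees Sg"
  by (subst trees.simps) auto

lemma list_decode_alph_encode [simp]: "list_decode (alph_encode A) = map prod_encode A"
  by (simp add: alph_encode_def)

lemma tree_test_iff: "tree_test (alph_encode A) t \<longleftrightarrow> t \<in> trees (alph_of A)"
  unfolding tree_test_def
proof (induction t)
  case (Node a ts)
  then show ?case
    unfolding crec_enc Node_in_trees_iff
    by (auto simp: alph_of_def list_all_iff inj_image_mem_iff[OF inj_prod_encode])
qed

lemma item_encode [simp]: "i < length ns \<Longrightarrow> item i (list_encode ns) = ns ! i"
  by (simp add: item_def hd_drop_conv_nth)

text \<open>\<open>hd\<close> of the filtered list is the first matching entry, which is also the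
  one that \<open>map_of\<close> returns. Injectivity of \<open>key\<close> makes agreement of the
  two stored components the same as equality of keys.\<close>

lemma lookup_table:
  assumes "inj key" "k \<in> fst ` set T"
  shows "lookup (list_encode (map (\<lambda>(k, v). list_encode [fst (key k), snd (key k), val v]) T))
      (fst (key k)) (snd (key k)) = val (table_fun T k)"
proof -
  let ?e = "\<lambda>(k, v). list_encode [fst (key k), snd (key k), val v]"
  let ?P = "\<lambda>n. item 0 n = fst (key k) \<and> item 1 n = snd (key k)"
  have P: "?P (?e (k', v)) \<longleftrightarrow> k' = k" for k' v
    using assms(1) by (auto dest: injD intro: prod_eqI)
  have "item 2 (hd (filter ?P (map ?e T))) = val (table_fun T k)"
    using assms(2)
  proof (induction T)
    case (Cons p T)
    obtain k' v where p: "p = (k', v)" by (cases p)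
    show ?case
    proof (cases "k' = k")
      case True
      then have "filter ?P (map ?e (p # T)) = ?e (k, v) # filter ?P (map ?e T)"
        unfolding list.map filter.simps p using P[of k' v] by simp
      then show ?thesis by (simp add: p True table_fun_def del: filter.simps list.map)
    next
      case False
      then have "filter ?P (map ?e (p # T)) = filter ?P (map ?e T)"
        unfolding list.map filter.simps p using P[of k' v] by simp
      then show ?thesis using Cons False by (simp add: p table_fun_def del: filter.simps list.map)
    qed
  qed simp
  then show ?thesis unfolding lookup_def list_encode_inverse .
qed

definition run_code :: "nat \<Rightarrow> nat tree \<Rightarrow> nat" where
  "run_code T t = crec (\<lambda>n qs. lookup T (fst (prod_decode n)) (list_encode qs)) (enc t)"

lemma computable_run_code [computable_intros]:
  assumes "computable T" "computable t" shows "computable (\<lambda>x. run_code (T x) (t x))"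
  unfolding run_code_def by (intro computable_intros assms computable_compose[OF assms(1)])

definition accepts :: "nat \<Rightarrow> nat tree \<Rightarrow> bool" where
  "accepts D t \<longleftrightarrow> tree_test (item 0 D) t \<and> run_code (item 3 D) t \<in> set (list_decode (item 2 D))"

lemma computable_accepts [computable_intros]:
  assumes "computable D" "computable t" shows "computable (\<lambda>x. accepts (D x) (t x))"
  unfolding accepts_def by (intro computable_intros assms)

lemma accepts_iff:
  assumes "valid_fta D" shows "accepts (fta_encode D) t \<longleftrightarrow> t \<in> lang_of_fta D"
proof (cases D)
  case (FtaDesc A Q F T)
  let ?e = "list_encode (map (\<lambda>((a, qs), q). list_encode [a, list_encode qs, q]) T)"
  have look: "lookup ?e a (list_encode qs) = table_fun T (a, qs)"
    if "a \<in> alph_of A (length qs)" "set qs \<subseteq> set Q" for a qs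
  proof -
    have "inj (\<lambda>k::nat \<times> nat list. (fst k, list_encode (snd k)))"
      by (auto simp: inj_on_def list_encode_eq prod_eq_iff)
    moreover have "(a, qs) \<in> fst ` set T" using assms that FtaDesc by simp
    ultimately show ?thesis
      using lookup_table[of "\<lambda>k. (fst k, list_encode (snd k))" "(a, qs)" T "\<lambda>q. q"] by (simp add: case_prod_unfold)
  qed
  have run_code: "run_code ?e t = run (\<lambda>a qs. lookup ?e a (list_encode qs)) t" for t
    unfolding run_code_def
  proof (induction t)
    case (Node a ts)
    then show ?case unfolding crec_enc by (simp cong: map_cong)
  qed
  have "fta (alph_of A) (set Q) (set F) (\<lambda>a qs. table_fun T (a, qs))" using assms FtaDesc by simp
  then have run: "run_code ?e t = run (\<lambda>a qs. table_fun T (a, qs)) t" if "t \<in> trees (alph_of A)"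
    using run_cong[OF that _ look] run_code[of t] by simp
  have "accepts (fta_encode D) t \<longleftrightarrow> t \<in> trees (alph_of A) \<and> run_code ?e t \<in> set F"
    by (simp add: FtaDesc accepts_def tree_test_iff)
  also have "\<dots> \<longleftrightarrow> t \<in> lang_of_fta D"
    using run by (auto simp only: FtaDesc lang_of_fta.simps fta_lang_def mem_Collect_eq)
  finally show ?thesis .
qed

definition relabel_code :: "nat \<Rightarrow> nat tree \<Rightarrow> nat tree list" where
  "relabel_code R t = crec (\<lambda>n uss. concat (map (\<lambda>e. map (Node (item 2 e)) (product_lists uss))
     (filter (\<lambda>e. item 0 e = fst (prod_decode n) \<and> item 1 e = length uss) (list_decode R)))) (enc t)"

lemma computable_relabel_code [computable_intros]:
  assumes "computable R" "computable t" shows "computable (\<lambda>x. relabel_code (R x) (t x))"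
  unfolding relabel_code_def by (intro computable_intros assms computable_compose[OF assms(1)])

lemma relabel_code:
  "set (relabel_code (list_encode (map (\<lambda>(a, k, b). list_encode [a, k, b]) R)) t) =
    {u. relabels (\<lambda>k a. {b. (a, k, b) \<in> set R}) t u}"
proof (induction t)
  case (Node a ts)
  let ?R = "list_encode (map (\<lambda>(a, k, b). list_encode [a, k, b]) R)"
  let ?r = "\<lambda>k a. {b. (a, k, b) \<in> set R}"
  have code: "relabel_code ?R (Node a ts) = concat (map (\<lambda>e. map (Node (item 2 e))
      (product_lists (map (relabel_code ?R) ts)))
     (filter (\<lambda>e. item 0 e = a \<and> item 1 e = length ts) (map (\<lambda>(a, k, b). list_encode [a, k, b]) R)))"
    unfolding relabel_code_def crec_enc by simp
  have entry: "e \<in> set (filter (\<lambda>e. item 0 e = a \<and> item 1 e = length ts)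
      (map (\<lambda>(a, k, b). list_encode [a, k, b]) R)) \<longleftrightarrow>
      (\<exists>b. (a, length ts, b) \<in> set R \<and> e = list_encode [a, length ts, b])" for e
  proof
    assume "\<exists>b. (a, length ts, b) \<in> set R \<and> e = list_encode [a, length ts, b]"
    then obtain b where b: "(a, length ts, b) \<in> set R" and e: "e = list_encode [a, length ts, b]" by blast
    from b have "(\<lambda>(a, k, b). list_encode [a, k, b]) (a, length ts, b) \<in>
        set (map (\<lambda>(a, k, b). list_encode [a, k, b]) R)" unfolding set_map by (rule imageI)
    then show "e \<in> set (filter (\<lambda>e. item 0 e = a \<and> item 1 e = length ts)
      (map (\<lambda>(a, k, b). list_encode [a, k, b]) R))" by (simp add: e del: set_map)
  qed auto
  have concat: "u \<in> set (concat (map g es)) \<longleftrightarrow> (\<exists>e. e \<in> set es \<and> u \<in> set (g e))"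
    for u :: "nat tree" and g and es :: "nat list" by auto
  have members: "u \<in> set (relabel_code ?R (Node a ts)) \<longleftrightarrow>
      (\<exists>b us. (a, length ts, b) \<in> set R \<and> us \<in> set (product_lists (map (relabel_code ?R) ts)) \<and> u = Node b us)"
    for u unfolding code concat entry set_map[of "Node _"] by auto
  have factors: "us \<in> set (product_lists (map (relabel_code ?R) ts)) \<longleftrightarrow> list_all2 (relabels ?r) ts us" for us
    unfolding product_lists_set list_all2_conv_all_nth mem_Collect_eq using Node by auto
  have "relabels ?r (Node a ts) u \<longleftrightarrow>
      (\<exists>b us. (a, length ts, b) \<in> set R \<and> list_all2 (relabels ?r) ts us \<and> u = Node b us)" for u
    by (subst relabels.simps) auto
  then show ?case unfolding set_eq_iff members factors by simp
qed

text \<open>Label 0 marks a variable with its index in the second component; other labels are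
  shifted by one, hence the subtraction. The index is read from the whole code \<open>n\<close>,
  which is why \<open>crec\<close> hands over more than the label.\<close>

definition subst_code :: "nat tree list \<Rightarrow> nat \<Rightarrow> nat tree" where
  "subst_code us v = crec (\<lambda>n ws. if fst (prod_decode n) = 0 then hd (drop (snd (prod_decode n)) us)
     else Node (fst (prod_decode n) - 1) ws) v"

lemma computable_subst_code [computable_intros]:
  assumes "computable us" "computable v" shows "computable (\<lambda>x. subst_code (us x) (v x))"
  unfolding subst_code_def by (intro computable_intros assms computable_compose[OF assms(1)])

lemma subst_code: "v \<in> vtrees Dl (length us) \<Longrightarrow> subst_code us (vtree_encode v) = subst us v"
proof (induction rule: vtrees.induct)
  case (1 i)
  then show ?case by (simp add: subst_code_def crec.simps[of _ "prod_encode _"] hd_drop_conv_nth)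
next
  case (2 a vs)
  then show ?case by (simp add: subst_code_def crec.simps[of _ "prod_encode _"] comp_def)
qed

definition hom_code :: "nat \<Rightarrow> nat tree \<Rightarrow> nat tree" where
  "hom_code H t = crec (\<lambda>n us. subst_code us (lookup H (fst (prod_decode n)) (length us))) (enc t)"

lemma computable_hom_code [computable_intros]:
  assumes "computable H" "computable t" shows "computable (\<lambda>x. hom_code (H x) (t x))"
  unfolding hom_code_def by (intro computable_intros assms computable_compose[OF assms(1)])

lemma hom_code:
  assumes "valid_trans (HomDesc A B H)" "t \<in> trees (alph_of A)"
  shows "hom_code (list_encode (map (\<lambda>((a, k), v). list_encode [a, k, vtree_encode v]) H)) t =
    hom (\<lambda>k a. table_fun H (a, k)) t"
  using assms(2) unfolding hom_code_def
proof (induction rule: trees.induct)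
  case (1 a ts)
  let ?e = "list_encode (map (\<lambda>((a, k), v). list_encode [a, k, vtree_encode v]) H)"
  have a: "(a, length ts) \<in> set A" using 1 by (simp add: alph_of_def)
  then have "lookup ?e a (length ts) = vtree_encode (table_fun H (a, length ts))"
    using lookup_table[of "\<lambda>k. k" "(a, length ts)" H vtree_encode] assms(1)
    by (auto simp: case_prod_unfold)
  moreover have "table_fun H (a, length ts) \<in> vtrees (alph_of B) (length ts)"
    using assms(1) 1 by (simp add: homomorphism_def)
  ultimately show ?case using 1 unfolding crec_enc by (simp add: subst_code cong: map_cong)
qed

text \<open>A tree has finitely many images under each basic transformation, so they can be listed.
  The tags 0, 1 and 2 are those of \<open>trans_encode\<close>; a tree outside the domain has no
  image.\<close>

definition images :: "nat \<Rightarrow> nat tree \<Rightarrow> nat tree list" where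
  "images E t =
    (if item 0 E = 0 then (if tree_test (item 1 E) t then relabel_code (item 3 E) t else [])
     else if item 0 E = 1 then (if accepts (item 1 E) t then [t] else [])
     else (if tree_test (item 1 E) t then [hom_code (item 3 E) t] else []))"

lemma computable_images [computable_intros]:
  assumes "computable E" "computable t" shows "computable (\<lambda>x. images (E x) (t x))"
  unfolding images_def by (intro computable_intros assms)

lemma set_images:
  assumes "valid_trans E" shows "set (images (trans_encode E) t) = trans_of E `` {t}"
proof (cases E)
  case (RelDesc A B R)
  then show ?thesis
    by (auto simp: images_def tree_test_iff relabel_code rel_trans_def)
next
  case (RestrDesc D)
  then show ?thesis using assms
    by (auto simp: images_def accepts_iff)
next
  case (HomDesc A B H)
  then show ?thesis using assms hom_code[of A B H t]
    by (auto simp: images_def tree_test_iff hom_trans_def simp del: valid_trans.simps)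
qed

lemma set_fold_images:
  assumes "\<forall>E \<in> set Es. valid_trans E"
  shows "set (fold (\<lambda>E us. concat (map (images E) us)) (map trans_encode Es) ts) =
    compose (map trans_of Es) `` set ts"
  using assms
proof (induction Es arbitrary: ts)
  case (Cons E Es)
  have "(\<Union>t \<in> set ts. trans_of E `` {t}) = trans_of E `` set ts" by auto
  with Cons show ?case by (simp add: set_images compose_def relcomp_Image)
qed (simp add: compose_def)

definition trees_below :: "nat \<Rightarrow> nat \<Rightarrow> nat tree list" where
  "trees_below A h = ((\<lambda>ts. concat (map (\<lambda>c. map (Node (fst (prod_decode c)))
     (List.n_lists (snd (prod_decode c)) ts)) (list_decode A))) ^^ h) []"

lemma computable_trees_below [computable_intros]:
  assumes "computable A" "computable h" shows "computable (\<lambda>x. trees_below (A x) (h x))"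
  unfolding trees_below_def by (intro computable_intros assms computable_compose[OF assms(1)])

lemma set_trees_below:
  "set (trees_below (alph_encode A) h) = {t \<in> trees (alph_of A). height t < h}"
proof (induction h)
  case (Suc h)
  have "t \<in> set (trees_below (alph_encode A) (Suc h)) \<longleftrightarrow> t \<in> trees (alph_of A) \<and> height t < Suc h" for t
  proof (cases t)
    case (Node a ts)
    have "t \<in> set (trees_below (alph_encode A) (Suc h)) \<longleftrightarrow>
        (a, length ts) \<in> set A \<and> set ts \<subseteq> set (trees_below (alph_encode A) h)"
    proof -
      have "t \<in> set (trees_below (alph_encode A) (Suc h)) \<longleftrightarrow>
          (\<exists>p \<in> set A. t \<in> Node (fst p) ` set (List.n_lists (snd p) (trees_below (alph_encode A) h)))"
        unfolding trees_below_def by simp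
      also have "\<dots> \<longleftrightarrow> (a, length ts) \<in> set A \<and> set ts \<subseteq> set (trees_below (alph_encode A) h)"
        unfolding Node set_n_lists by (auto intro!: bexI[of _ "(a, length ts)"])
      finally show ?thesis .
    qed
    then show ?thesis
      unfolding Suc unfolding Node less_Suc_eq_le height_le_iff Node_in_trees_iff by (auto simp: alph_of_def)
  qed
  then show ?case by blast
qed (simp add: trees_below_def)

section \<open>Path automata with regular look-ahead\<close>

text \<open>
  In path state \<open>p\<close> at a node with label \<open>a\<close> whose subtrees have the look-ahead states \<open>qs\<close>, the
  automaton may stop with a value in \<open>C p a qs\<close>, or for \<open>(w, j, p') \<in> W p a qs\<close> add the weight \<open>w\<close>
  and move to subtree number \<open>j\<close> in path state \<open>p'\<close>.
\<close>

inductive path_value ::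
  "('a \<Rightarrow> nat list \<Rightarrow> nat) \<Rightarrow> (nat \<Rightarrow> 'a \<Rightarrow> nat list \<Rightarrow> nat set) \<Rightarrow>
   (nat \<Rightarrow> 'a \<Rightarrow> nat list \<Rightarrow> (nat \<times> nat \<times> nat) set) \<Rightarrow> nat \<Rightarrow> 'a tree \<Rightarrow> nat \<Rightarrow> bool"
  for \<delta> C W where
  stop: "c \<in> C p a (map (run \<delta>) ts) \<Longrightarrow> path_value \<delta> C W p (Node a ts) c"
| step: "(w, j, p') \<in> W p a (map (run \<delta>) ts) \<Longrightarrow> j < length ts \<Longrightarrow> path_value \<delta> C W p' (ts ! j) n \<Longrightarrow>
    path_value \<delta> C W p (Node a ts) (w + n)"

lemma path_value_Node_iff:
  "path_value \<delta> C W p (Node a ts) n \<longleftrightarrow> n \<in> C p a (map (run \<delta>) ts) \<or>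
    (\<exists>w j p' m. (w, j, p') \<in> W p a (map (run \<delta>) ts) \<and> j < length ts \<and>
      path_value \<delta> C W p' (ts ! j) m \<and> n = w + m)"
  by (subst path_value.simps) auto

text \<open>Only look-ahead lists that arise from actual trees matter. This permits recoding the
  look-ahead as a product or with default values.\<close>

lemma path_value_cong:
  assumes "\<And>p a ts. C' p a (map (run \<delta>') ts) = C p a (map (run \<delta>) ts)"
    and "\<And>p a ts. W' p a (map (run \<delta>') ts) = W p a (map (run \<delta>) ts)"
  shows "path_value \<delta>' C' W' p t n \<longleftrightarrow> path_value \<delta> C W p t n"
proof (induction t arbitrary: p n)
  case (Node a ts)
  have "path_value \<delta>' C' W' q (ts ! j) m \<longleftrightarrow> path_value \<delta> C W q (ts ! j) m" if "j < length ts" for q j m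
    using Node that by simp
  then show ?case unfolding path_value_Node_iff assms by (simp cong: conj_cong)
qed

text \<open>One number bounds look-ahead states, path states, weights and stop values, since the
  final bounds depend on nothing else. The child index needs no bound of its own, as
  \<open>path_value\<close> compares it with the number of children.\<close>

definition path_bounded :: "nat \<Rightarrow> ('a \<Rightarrow> nat list \<Rightarrow> nat) \<Rightarrow> (nat \<Rightarrow> nat set) \<Rightarrow>
    (nat \<Rightarrow> 'a \<Rightarrow> nat list \<Rightarrow> nat set) \<Rightarrow> (nat \<Rightarrow> 'a \<Rightarrow> nat list \<Rightarrow> (nat \<times> nat \<times> nat) set) \<Rightarrow> bool" where
  "path_bounded N \<delta> I C W \<longleftrightarrow>
     (\<forall>a qs. set qs \<subseteq> {..<N} \<longrightarrow> \<delta> a qs < N) \<and> (\<forall>q. I q \<subseteq> {..<N}) \<and>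
     (\<forall>p a qs. C p a qs \<subseteq> {..<N} \<and> W p a qs \<subseteq> {..<N} \<times> UNIV \<times> {..<N})"

text \<open>The initial path states may depend on the look-ahead state of the root. This is where a
  restriction of the whole tree takes effect.\<close>

definition path_recognizable :: "nat \<Rightarrow> ('a tree \<Rightarrow> nat set) \<Rightarrow> bool" where
  "path_recognizable N S \<longleftrightarrow> (\<exists>\<delta> I C W. path_bounded N \<delta> I C W \<and>
     (\<forall>t n. n \<in> S t \<longleftrightarrow> (\<exists>p \<in> I (run \<delta> t). path_value \<delta> C W p t n)))"

lemma path_recognizableI:
  assumes "path_bounded N \<delta> I C W"
    and "\<And>t n. n \<in> S t \<longleftrightarrow> (\<exists>p \<in> I (run \<delta> t). path_value \<delta> C W p t n)"
  shows "path_recognizable N S"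
  using assms unfolding path_recognizable_def by blast

lemma run_less:
  assumes "\<And>a qs. set qs \<subseteq> {..<N} \<Longrightarrow> \<delta> a qs < N" shows "run \<delta> t < N"
  by (induction t) (use assms in \<open>force simp: image_subset_iff\<close>)

lemma path_bounded_pos: "path_bounded N \<delta> I C W \<Longrightarrow> 0 < N"
  unfolding path_bounded_def by (metis empty_subsetI gr_zeroI list.set(1) not_less_zero)

lemma path_bounded_weaken:
  assumes "\<And>a qs. set qs \<subseteq> {..<M} \<Longrightarrow> \<delta> a qs < M" "N \<le> M" "\<And>q. I q \<subseteq> {..<N}"
    and "\<And>p a qs. C p a qs \<subseteq> {..<N}" "\<And>p a qs. W p a qs \<subseteq> {..<N} \<times> UNIV \<times> {..<N}"
  shows "path_bounded M \<delta> I C W"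
proof -
  have "{..<N} \<subseteq> {..<M}" using assms(2) by auto
  then have "{..<N} \<times> (UNIV :: nat set) \<times> {..<N} \<subseteq> {..<M} \<times> UNIV \<times> {..<M}" by auto
  with \<open>{..<N} \<subseteq> {..<M}\<close> show ?thesis
    unfolding path_bounded_def using assms(1,3-5) by (meson subset_trans)
qed

lemma path_boundedD:
  assumes "path_bounded N \<delta> I C W"
  shows "set qs \<subseteq> {..<N} \<Longrightarrow> \<delta> a qs < N" "I q \<subseteq> {..<N}" "C p a qs \<subseteq> {..<N}"
    "W p a qs \<subseteq> {..<N} \<times> UNIV \<times> {..<N}"
  using assms unfolding path_bounded_def by blast+

lemma path_recognizable_mono:
  assumes "path_recognizable N S" "N \<le> N'" shows "path_recognizable N' S"
proof -
  obtain \<delta> I C W where b: "path_bounded N \<delta> I C W"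
    and S: "\<And>t n. n \<in> S t \<longleftrightarrow> (\<exists>p \<in> I (run \<delta> t). path_value \<delta> C W p t n)"
    using assms(1) unfolding path_recognizable_def by blast
  \<comment> \<open>The larger bound also demands closure on lists of states below
    \<open>N'\<close>, about which nothing is known. The default 0 is used only on lists that no run
    produces.\<close>
  define \<delta>' where "\<delta>' a qs = (if set qs \<subseteq> {..<N} then \<delta> a qs else 0)" for a qs
  have run: "run \<delta> t < N" for t using b by (intro run_less) (auto simp: path_bounded_def)
  have run': "run \<delta>' t = run \<delta> t" for t
  proof (induction t)
    case (Node a ts)
    then have "map (run \<delta>') ts = map (run \<delta>) ts" by simp
    moreover have "set (map (run \<delta>) ts) \<subseteq> {..<N}" using run by auto
    ultimately show ?case unfolding run.simps by (simp only: \<delta>'_def if_True)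
  qed
  then have "map (run \<delta>') ts = map (run \<delta>) ts" for ts by simp
  then have pv: "path_value \<delta>' C W p t n = path_value \<delta> C W p t n" for p t n
    by (intro path_value_cong) (simp_all only:)
  show ?thesis
  proof (rule path_recognizableI)
    show "path_bounded N' \<delta>' I C W"
    proof (rule path_bounded_weaken[OF _ assms(2) path_boundedD(2-4)[OF b]])
      have "\<delta>' a qs < N" for a qs
        using path_boundedD(1)[OF b] path_bounded_pos[OF b] by (simp add: \<delta>'_def)
      then show "\<delta>' a qs < N'" for a qs using assms(2) by (rule less_le_trans)
    qed
    show "n \<in> S t \<longleftrightarrow> (\<exists>p \<in> I (run \<delta>' t). path_value \<delta>' C W p t n)" for t n
      unfolding S run' pv ..
  qed
qed

section \<open>Height, restrictions and relabelings\<close>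

lemma le_height_iff: "n \<le> height (Node a ts) \<longleftrightarrow> n = 0 \<or> (\<exists>t \<in> set ts. n \<le> Suc (height t))"
  by (induction ts) (auto simp: le_max_iff_disj)

text \<open>Every edge weighs 1 and a path may stop anywhere with value 0, so all numbers up to the
  height occur. The bound is 2 because the weight 1 must lie below it.\<close>

lemma path_recognizable_height: "path_recognizable 2 (\<lambda>t. {..height t})"
proof (rule path_recognizableI)
  show "path_bounded 2 (\<lambda>_ _. 0) (\<lambda>_. {0}) (\<lambda>_ _ _. {0}) (\<lambda>_ _ _. {1} \<times> UNIV \<times> {0})"
    by (auto simp: path_bounded_def)
  have "n \<le> height t \<longleftrightarrow> path_value (\<lambda>_ _. 0) (\<lambda>_ _ _. {0}) (\<lambda>_ _ _. {1} \<times> UNIV \<times> {0}) 0 t n"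
    for t :: "'a tree" and n
  proof (induction t arbitrary: n)
    case (Node a ts)
    have "n \<le> height (Node a ts) \<longleftrightarrow> n = 0 \<or> (\<exists>j m. j < length ts \<and> m \<le> height (ts ! j) \<and> n = Suc m)"
      unfolding le_height_iff by (cases n) (auto simp: in_set_conv_nth Bex_def)
    then show ?case using Node by (auto simp: path_value_Node_iff)
  qed
  then show "n \<in> {..height t} \<longleftrightarrow> (\<exists>p \<in> {0}. path_value (\<lambda>_ _. 0) (\<lambda>_ _ _. {0}) (\<lambda>_ _ _. {1} \<times> UNIV \<times> {0}) p t n)"
    for t :: "'a tree" and n by simp
qed

text \<open>Product construction on the look-ahead, with the pair of \<open>q\<close> and
  \<open>q'\<close> coded as \<open>q * K + q'\<close>. Membership in \<open>F\<close> is tested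
  once, at the root, by emptying \<open>I\<close>; the walk itself is unchanged.\<close>

lemma path_recognizable_restrict:
  assumes S: "path_recognizable N S" and K: "\<And>a qs. \<delta>' a qs < K"
  shows "path_recognizable (N * K) (\<lambda>t. if run \<delta>' t \<in> F then S t else {})"
proof -
  obtain \<delta> I C W where b: "path_bounded N \<delta> I C W"
    and S: "\<And>t n. n \<in> S t \<longleftrightarrow> (\<exists>p \<in> I (run \<delta> t). path_value \<delta> C W p t n)"
    using S unfolding path_recognizable_def by blast
  have "0 < K" using K[of undefined "[]"] by simp
  define fsts where "fsts = map (\<lambda>s. s div K)"
  define \<gamma> where "\<gamma> a ss = \<delta> a (fsts ss) * K + \<delta>' a (map (\<lambda>s. s mod K) ss)" for a ss
  have run: "run \<gamma> t = run \<delta> t * K + run \<delta>' t" for t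
  proof (induction t)
    case (Node a ts)
    have "run \<delta>' t < K" for t by (cases t) (simp add: K)
    then have "run \<gamma> t div K = run \<delta> t \<and> run \<gamma> t mod K = run \<delta>' t" if "t \<in> set ts" for t
      using Node[OF that] \<open>0 < K\<close> that by simp
    then have "fsts (map (run \<gamma>) ts) = map (run \<delta>) ts" "map (\<lambda>s. s mod K) (map (run \<gamma>) ts) = map (run \<delta>') ts"
      by (simp_all add: fsts_def)
    moreover have "\<gamma> a ss = \<delta> a (fsts ss) * K + \<delta>' a (map (\<lambda>s. s mod K) ss)" for ss
      by (simp add: \<gamma>_def)
    ultimately show ?case by (simp only: run.simps)
  qed
  have less: "run \<delta>' t < K" for t by (cases t) (simp add: K)
  then have run_div: "run \<gamma> t div K = run \<delta> t" and run_mod: "run \<gamma> t mod K = run \<delta>' t" for t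
    using \<open>0 < K\<close> by (simp_all add: run)
  then have fsts: "fsts (map (run \<gamma>) ts) = map (run \<delta>) ts" for ts by (simp add: fsts_def)
  let ?I = "\<lambda>s. if s mod K \<in> F then I (s div K) else {}"
  let ?C = "\<lambda>p a ss. C p a (fsts ss)" and ?W = "\<lambda>p a ss. W p a (fsts ss)"
  have pv: "path_value \<gamma> ?C ?W p t n = path_value \<delta> C W p t n" for p t n
    by (intro path_value_cong) (simp_all add: fsts)
  show ?thesis
  proof (rule path_recognizableI)
    have "\<gamma> a ss < N * K" if "set ss \<subseteq> {..<N * K}" for a ss
    proof -
      have "set (fsts ss) \<subseteq> {..<N}" using that by (auto simp: fsts_def less_mult_imp_div_less)
      then have "\<delta> a (fsts ss) * K + K \<le> N * K"
        using path_boundedD(1)[OF b] by (metis Suc_leI add.commute mult_Suc mult_le_mono1)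
      then show ?thesis unfolding \<gamma>_def using K[of a "map (\<lambda>s. s mod K) ss"] by linarith
    qed
    moreover have "N \<le> N * K" using \<open>0 < K\<close> by simp
    moreover have "?I q \<subseteq> {..<N}" for q using path_boundedD(2)[OF b] by simp
    ultimately show "path_bounded (N * K) \<gamma> ?I ?C ?W"
      by (rule path_bounded_weaken) (assumption | rule path_boundedD[OF b])+
    show "n \<in> (if run \<delta>' t \<in> F then S t else {}) \<longleftrightarrow> (\<exists>p \<in> ?I (run \<gamma> t). path_value \<gamma> ?C ?W p t n)" for t n
      by (simp add: S pv run_div run_mod)
  qed
qed

lemma set_encode_less: "A \<subseteq> {..<N} \<Longrightarrow> set_encode A < 2 ^ N"
proof -
  assume "A \<subseteq> {..<N}"
  then have "set_encode A \<le> (\<Sum>i<N. 2 ^ i)" unfolding set_encode_def by (intro sum_mono2) auto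
  also have "\<dots> < 2 ^ N" by (induction N) auto
  finally show ?thesis .
qed

lemma relabels_Node_iff:
  "relabels r (Node a ts) u \<longleftrightarrow> (\<exists>b us. b \<in> r (length ts) a \<and> list_all2 (relabels r) ts us \<and> u = Node b us)"
  by (subst relabels.simps) auto

text \<open>
  The look-ahead is the set of states reachable on some relabeled tree. A path state
  \<open>p * N + q\<close> guesses that the relabeled subtree is in state \<open>q\<close>.
\<close>

lemma path_recognizable_relabels:
  fixes S :: "'a tree \<Rightarrow> nat set"
  assumes "path_recognizable N S"
  shows "path_recognizable (4 ^ N) (\<lambda>t. \<Union>u \<in> {u. relabels r t u}. S u)"
proof -
  obtain \<delta> I C W where b: "path_bounded N \<delta> I C W"
    and S: "\<And>t n. n \<in> S t \<longleftrightarrow> (\<exists>p \<in> I (run \<delta> t). path_value \<delta> C W p t n)"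
    using assms unfolding path_recognizable_def by blast
  have run: "run \<delta> t < N" for t using b by (intro run_less) (auto simp: path_bounded_def)
  have pos: "0 < N" using path_bounded_pos[OF b] .
  \<comment> \<open>\<open>qs\<close> selects one state from each coded set in \<open>ss\<close>. On
    runs \<open>q < N\<close> holds anyway, but the step relation must also be bounded for arbitrary
    \<open>ss\<close>.\<close>
  define sel where "sel qs ss \<longleftrightarrow> list_all2 (\<lambda>q s. q < N \<and> q \<in> set_decode s) qs ss" for qs ss
  have sel_less: "set qs \<subseteq> {..<N}" if "sel qs ss" for qs ss
    using that unfolding sel_def by (auto simp: list_all2_conv_all_nth in_set_conv_nth)
  define \<gamma> where "\<gamma> a ss = set_encode {\<delta> b qs |b qs. b \<in> r (length ss) a \<and> sel qs ss}" for a ss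
  have \<gamma>_sub: "{\<delta> b qs |b qs. b \<in> r (length ss) a \<and> sel qs ss} \<subseteq> {..<N}" for a ss
    using path_boundedD(1)[OF b] sel_less by blast
  have decode: "set_decode (\<gamma> a ss) = {\<delta> b qs |b qs. b \<in> r (length ss) a \<and> sel qs ss}" for a ss
    unfolding \<gamma>_def using \<gamma>_sub by (intro set_encode_inverse) (meson finite_lessThan finite_subset)
  have sel_choice: "sel qs (map (run \<gamma>) ts) \<longleftrightarrow> (\<exists>us. list_all2 (relabels r) ts us \<and> qs = map (run \<delta>) us)"
    if "\<And>t. t \<in> set ts \<Longrightarrow> set_decode (run \<gamma> t) = {run \<delta> u |u. relabels r t u}" for qs ts
    using that
  proof (induction ts arbitrary: qs)
    case (Cons t ts)
    have head: "q < N \<and> q \<in> set_decode (run \<gamma> t) \<longleftrightarrow> (\<exists>u. relabels r t u \<and> q = run \<delta> u)" for q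
      using Cons.prems[of t] run by auto
    have tail: "sel qs (map (run \<gamma>) ts) \<longleftrightarrow> (\<exists>us. list_all2 (relabels r) ts us \<and> qs = map (run \<delta>) us)" for qs
      using Cons by simp
    have "sel qs (map (run \<gamma>) (t # ts)) \<longleftrightarrow>
        (\<exists>q qs'. qs = q # qs' \<and> (q < N \<and> q \<in> set_decode (run \<gamma> t)) \<and> sel qs' (map (run \<gamma>) ts))"
      unfolding sel_def by (simp add: list_all2_Cons2)
    also have "\<dots> \<longleftrightarrow> (\<exists>u us. (relabels r t u \<and> list_all2 (relabels r) ts us) \<and> qs = run \<delta> u # map (run \<delta>) us)"
      unfolding head tail by blast
    also have "\<dots> \<longleftrightarrow> (\<exists>us. list_all2 (relabels r) (t # ts) us \<and> qs = map (run \<delta>) us)"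
    proof
      assume "\<exists>u us. (relabels r t u \<and> list_all2 (relabels r) ts us) \<and> qs = run \<delta> u # map (run \<delta>) us"
      then obtain u us where "relabels r t u" "list_all2 (relabels r) ts us" "qs = run \<delta> u # map (run \<delta>) us"
        by blast
      then show "\<exists>us. list_all2 (relabels r) (t # ts) us \<and> qs = map (run \<delta>) us"
        by (intro exI[of _ "u # us"]) simp
    next
      assume "\<exists>us. list_all2 (relabels r) (t # ts) us \<and> qs = map (run \<delta>) us"
      then obtain u us where "relabels r t u" "list_all2 (relabels r) ts us" "qs = map (run \<delta>) (u # us)"
        by (auto simp only: list_all2_Cons1)
      then show "\<exists>u us. (relabels r t u \<and> list_all2 (relabels r) ts us) \<and> qs = run \<delta> u # map (run \<delta>) us"
        by (intro exI[of _ u] exI[of _ us]) simp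
    qed
    finally show ?case .
  qed (simp add: sel_def)
  have run_\<gamma>: "set_decode (run \<gamma> t) = {run \<delta> u |u. relabels r t u}" for t
  proof (induction t)
    case (Node a ts)
    have sel: "sel qs (map (run \<gamma>) ts) \<longleftrightarrow> (\<exists>us. list_all2 (relabels r) ts us \<and> qs = map (run \<delta>) us)" for qs
      by (rule sel_choice) (rule Node)
    have "set_decode (run \<gamma> (Node a ts)) =
        {\<delta> b qs |b qs. b \<in> r (length ts) a \<and> sel qs (map (run \<gamma>) ts)}"
      unfolding run.simps decode length_map ..
    also have "\<dots> = {run \<delta> (Node b us) |b us. b \<in> r (length ts) a \<and> list_all2 (relabels r) ts us}"
      unfolding sel run.simps by blast
    also have "\<dots> = {run \<delta> u |u. relabels r (Node a ts) u}" unfolding relabels_Node_iff by blast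
    finally show ?case .
  qed
  note sel = sel_choice[OF run_\<gamma>]
  define I' where "I' s = {p * N + q |p q. q < N \<and> q \<in> set_decode s \<and> p \<in> I q}" for s
  \<comment> \<open>\<open>p div N\<close> is the original path state and \<open>p mod N\<close> the
    guessed state of the relabeled subtree. The local guess of \<open>b\<close> and
    \<open>qs\<close> must produce that state, and \<open>qs ! j\<close> becomes the guess at the
    child entered; the guesses for the siblings are justified by the look-ahead alone.\<close>
  define C' where "C' p a ss = {c. \<exists>b qs. b \<in> r (length ss) a \<and> sel qs ss \<and> \<delta> b qs = p mod N \<and>
    c \<in> C (p div N) b qs}" for p a ss
  define W' where "W' p a ss = {(w, j, p' * N + qs ! j) |w j p' b qs. b \<in> r (length ss) a \<and> sel qs ss \<and>
    \<delta> b qs = p mod N \<and> j < length ss \<and> (w, j, p') \<in> W (p div N) b qs}" for p a ss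
  have pv: "path_value \<gamma> C' W' s t n \<longleftrightarrow>
      (\<exists>u. relabels r t u \<and> run \<delta> u = s mod N \<and> path_value \<delta> C W (s div N) u n)" for s t n
  proof (induction t arbitrary: s n)
    case (Node a ts)
    show ?case
    proof
      assume "path_value \<gamma> C' W' s (Node a ts) n"
      then consider (stop) "n \<in> C' s a (map (run \<gamma>) ts)"
        | (step) w j p m where "(w, j, p) \<in> W' s a (map (run \<gamma>) ts)" "j < length ts"
          "path_value \<gamma> C' W' p (ts ! j) m" "n = w + m"
        unfolding path_value_Node_iff by blast
      then show "\<exists>u. relabels r (Node a ts) u \<and> run \<delta> u = s mod N \<and> path_value \<delta> C W (s div N) u n"
      proof cases
        case stop
        then obtain b qs where *: "b \<in> r (length ts) a" "sel qs (map (run \<gamma>) ts)"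
          "\<delta> b qs = s mod N" "n \<in> C (s div N) b qs"
          unfolding C'_def W'_def length_map by blast
        then obtain us where us: "list_all2 (relabels r) ts us" "qs = map (run \<delta>) us"
          unfolding sel by blast
        have "relabels r (Node a ts) (Node b us)" unfolding relabels_Node_iff using *(1) us(1) by blast
        moreover have "run \<delta> (Node b us) = s mod N" using *(3) us(2) by simp
        moreover have "path_value \<delta> C W (s div N) (Node b us) n"
          using *(4) unfolding us(2) by (rule path_value.stop)
        ultimately show ?thesis by blast
      next
        case (step w j p m)
        then obtain p' b qs where sel_qs: "sel qs (map (run \<gamma>) ts)" and p: "p = p' * N + qs ! j"
          and b: "b \<in> r (length ts) a" "\<delta> b qs = s mod N" "(w, j, p') \<in> W (s div N) b qs"
          unfolding C'_def W'_def length_map by blast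
        from sel_qs obtain us where us: "list_all2 (relabels r) ts us" "qs = map (run \<delta>) us"
          unfolding sel by blast
        note * = b(1) us(1) b(2)[unfolded us(2)] p[unfolded us(2)] b(3)[unfolded us(2)]
        have len: "length us = length ts" using *(2) by (simp add: list_all2_lengthD)
        then have p: "p div N = p'" "p mod N = run \<delta> (us ! j)"
          using *(4) step(2) run pos by simp_all
        \<comment> \<open>The induction hypothesis yields some relabeling of the child, not
          necessarily \<open>us ! j\<close>. It has the same look-ahead state, so it can be swapped
          in without changing any state that the step depends on.\<close>
        obtain u where u: "relabels r (ts ! j) u" "run \<delta> u = run \<delta> (us ! j)" "path_value \<delta> C W p' u m"
          using Node[OF nth_mem[OF step(2)], of p m] step(3) p by auto
        let ?us = "us[j := u]"
        have runs: "map (run \<delta>) ?us = map (run \<delta>) us"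
          using u(2) by (metis list_update_id list_update_beyond map_update not_le nth_map)
        have "list_all2 (relabels r) ts ?us"
          using list_all2_update_cong[OF *(2) u(1), of j] by simp
        moreover have "path_value \<delta> C W (s div N) (Node b ?us) n"
          unfolding step(4)
        proof (rule path_value.step)
          show "(w, j, p') \<in> W (s div N) b (map (run \<delta>) ?us)" unfolding runs by (rule *(5))
          show "j < length ?us" using step(2) len by simp
          then show "path_value \<delta> C W p' (?us ! j) m" using u(3) by simp
        qed
        moreover have "run \<delta> (Node b ?us) = s mod N" unfolding run.simps runs by (rule *(3))
        ultimately show ?thesis using *(1) unfolding relabels_Node_iff by blast
      qed
    next
      assume "\<exists>u. relabels r (Node a ts) u \<and> run \<delta> u = s mod N \<and> path_value \<delta> C W (s div N) u n"
      then obtain b us where b: "b \<in> r (length ts) a" and us: "list_all2 (relabels r) ts us"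
        and q: "\<delta> b (map (run \<delta>) us) = s mod N" and pv: "path_value \<delta> C W (s div N) (Node b us) n"
        unfolding relabels_Node_iff by auto
      have len: "length us = length ts" using us by (simp add: list_all2_lengthD)
      have sel_us: "sel (map (run \<delta>) us) (map (run \<gamma>) ts)" unfolding sel using us by blast
      from pv consider "n \<in> C (s div N) b (map (run \<delta>) us)"
        | w j p m where "(w, j, p) \<in> W (s div N) b (map (run \<delta>) us)" "j < length us"
          "path_value \<delta> C W p (us ! j) m" "n = w + m"
        unfolding path_value_Node_iff by blast
      then show "path_value \<gamma> C' W' s (Node a ts) n"
      proof cases
        case 1
        then have "n \<in> C' s a (map (run \<gamma>) ts)" using b q sel_us unfolding C'_def W'_def length_map by blast
        then show ?thesis by (rule path_value.stop)
      next
        case 2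
        have "path_value \<gamma> C' W' (p * N + run \<delta> (us ! j)) (ts ! j) m"
          using 2 us run pos len by (subst Node) (auto simp: list_all2_conv_all_nth)
        moreover have "(w, j, p * N + map (run \<delta>) us ! j) \<in> W' s a (map (run \<gamma>) ts)"
          using 2(1,2) b q sel_us unfolding W'_def len length_map by blast
        then have "(w, j, p * N + run \<delta> (us ! j)) \<in> W' s a (map (run \<gamma>) ts)"
          by (simp only: nth_map[OF 2(2)])
        ultimately show ?thesis
          unfolding 2(4) using 2(2) len by (intro path_value.step[of w j "p * N + run \<delta> (us ! j)"]) simp_all
      qed
    qed
  qed
  show ?thesis
  proof (rule path_recognizableI)
    \<comment> \<open>Coded pairs lie below \<open>N * N\<close> and coded sets of states below
      \<open>2 ^ N\<close>; both are at most \<open>4 ^ N\<close> because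
      \<open>N < 2 ^ N\<close>.\<close>
    have small: "p * N + q < 4 ^ N" if "p < N" "q < N" for p q
    proof -
      have "p * N + q < Suc p * N" using that by simp
      also have "\<dots> \<le> N * N" using that by (intro mult_le_mono1) simp
      also have "\<dots> \<le> 2 ^ N * 2 ^ N" by (intro mult_le_mono less_imp_le[OF less_exp])
      also have "\<dots> = 4 ^ N" by (simp flip: power_mult_distrib)
      finally show ?thesis .
    qed
    have N: "k < 4 ^ N" if "k < N" for k using small[OF pos that] by simp
    have "\<gamma> a ss < 4 ^ N" for a ss
    proof -
      have "\<gamma> a ss < 2 ^ N" unfolding \<gamma>_def by (rule set_encode_less[OF \<gamma>_sub])
      also have "(2::nat) ^ N \<le> 4 ^ N" by (rule power_mono) auto
      finally show ?thesis .
    qed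
    moreover have "C' p a ss \<subseteq> {..<4 ^ N}" for p a ss
    proof
      fix c assume "c \<in> C' p a ss"
      then obtain b qs where "c \<in> C (p div N) b qs" unfolding C'_def by blast
      then have "c < N" using path_boundedD(3)[OF b] by blast
      then show "c \<in> {..<4 ^ N}" using N by simp
    qed
    moreover have "W' p a ss \<subseteq> {..<4 ^ N} \<times> UNIV \<times> {..<4 ^ N}" for p a ss
    proof
      fix x assume "x \<in> W' p a ss"
      then obtain w j p' b' qs where x: "x = (w, j, p' * N + qs ! j)"
        and *: "sel qs ss" "j < length ss" "(w, j, p') \<in> W (p div N) b' qs" unfolding W'_def by blast
      have "qs ! j < N" using *(1,2) by (simp add: sel_def list_all2_conv_all_nth)
      moreover have "w < N" "p' < N" using path_boundedD(4)[OF b] *(3) by blast+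
      ultimately show "x \<in> {..<4 ^ N} \<times> UNIV \<times> {..<4 ^ N}" using N small by (simp add: x)
    qed
    moreover have "I' q \<subseteq> {..<4 ^ N}" for q
    proof
      fix s assume "s \<in> I' q"
      then obtain p q' where "s = p * N + q'" "q' < N" "p \<in> I q'" unfolding I'_def by blast
      moreover from this have "p < N" using path_boundedD(2)[OF b] by blast
      ultimately show "s \<in> {..<4 ^ N}" using small by simp
    qed
    ultimately show "path_bounded (4 ^ N) \<gamma> I' C' W'" unfolding path_bounded_def by (intro conjI allI impI)
    show "n \<in> (\<Union>u \<in> {u. relabels r t u}. S u) \<longleftrightarrow> (\<exists>p \<in> I' (run \<gamma> t). path_value \<gamma> C' W' p t n)" for t n
    proof
      assume "n \<in> (\<Union>u \<in> {u. relabels r t u}. S u)"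
      then obtain u p where u: "relabels r t u" "p \<in> I (run \<delta> u)" "path_value \<delta> C W p u n" using S by blast
      then have "p * N + run \<delta> u \<in> I' (run \<gamma> t)" using run unfolding I'_def run_\<gamma> by blast
      moreover have "path_value \<gamma> C' W' (p * N + run \<delta> u) t n" unfolding pv using u run pos by auto
      ultimately show "\<exists>p \<in> I' (run \<gamma> t). path_value \<gamma> C' W' p t n" by blast
    next
      assume "\<exists>p \<in> I' (run \<gamma> t). path_value \<gamma> C' W' p t n"
      then obtain p q where "q < N" "p \<in> I q" "path_value \<gamma> C' W' (p * N + q) t n" unfolding I'_def by blast
      then show "n \<in> (\<Union>u \<in> {u. relabels r t u}. S u)" unfolding pv using S by auto
    qed
  qed
qed

section \<open>Inverse images under homomorphisms\<close>

primrec vrun :: "('a \<Rightarrow> nat list \<Rightarrow> nat) \<Rightarrow> nat list \<Rightarrow> 'a vtree \<Rightarrow> nat" where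
  "vrun \<delta> qs (Var i) = qs ! i"
| "vrun \<delta> qs (VNode a vs) = \<delta> a (map (vrun \<delta> qs) vs)"

lemma run_subst:
  "v \<in> vtrees Dl (length us) \<Longrightarrow> run \<delta> (subst us v) = vrun \<delta> (map (run \<delta>) us) v"
proof (induction rule: vtrees.induct)
  case (2 a vs)
  then have "map (run \<delta>) (map (subst us) vs) = map (vrun \<delta> (map (run \<delta>) us)) vs" by simp
  then show ?case by (simp del: map_map map_eq_conv)
qed simp

lemma vrun_less:
  assumes "v \<in> vtrees Dl (length qs)" "set qs \<subseteq> {..<N}" "\<And>a qs. set qs \<subseteq> {..<N} \<Longrightarrow> \<delta> a qs < N"
  shows "vrun \<delta> qs v < N"
  using assms(1)
proof (induction rule: vtrees.induct)
  case (1 i)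
  then show ?case using assms(2) nth_mem by fastforce
next
  case (2 a vs)
  then have "set (map (vrun \<delta> qs) vs) \<subseteq> {..<N}" by auto
  then show ?case using assms(3) by simp
qed

text \<open>
  A path into \<open>subst us v\<close> either ends inside \<open>v\<close> (\<open>vstop\<close>) or leaves \<open>v\<close> at a variable
  (\<open>vexit\<close>) and continues in the tree substituted for it.
\<close>

inductive vstop :: "('a \<Rightarrow> nat list \<Rightarrow> nat) \<Rightarrow> (nat \<Rightarrow> 'a \<Rightarrow> nat list \<Rightarrow> nat set) \<Rightarrow>
    (nat \<Rightarrow> 'a \<Rightarrow> nat list \<Rightarrow> (nat \<times> nat \<times> nat) set) \<Rightarrow> nat list \<Rightarrow> nat \<Rightarrow> 'a vtree \<Rightarrow> nat \<Rightarrow> bool"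
  for \<delta> C W qs where
  "c \<in> C p a (map (vrun \<delta> qs) vs) \<Longrightarrow> vstop \<delta> C W qs p (VNode a vs) c"
| "(w, j, p') \<in> W p a (map (vrun \<delta> qs) vs) \<Longrightarrow> j < length vs \<Longrightarrow> vstop \<delta> C W qs p' (vs ! j) c \<Longrightarrow>
    vstop \<delta> C W qs p (VNode a vs) (w + c)"

inductive vexit :: "('a \<Rightarrow> nat list \<Rightarrow> nat) \<Rightarrow>
    (nat \<Rightarrow> 'a \<Rightarrow> nat list \<Rightarrow> (nat \<times> nat \<times> nat) set) \<Rightarrow> nat list \<Rightarrow>
    nat \<Rightarrow> 'a vtree \<Rightarrow> nat \<Rightarrow> nat \<Rightarrow> nat \<Rightarrow> bool"
  for \<delta> W qs where
  "vexit \<delta> W qs p (Var i) 0 i p"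
| "(w, j, p') \<in> W p a (map (vrun \<delta> qs) vs) \<Longrightarrow> j < length vs \<Longrightarrow> vexit \<delta> W qs p' (vs ! j) w' i p'' \<Longrightarrow>
    vexit \<delta> W qs p (VNode a vs) (w + w') i p''"

lemma vstop_Var: "\<not> vstop \<delta> C W qs p (Var i) c"
  by (auto elim: vstop.cases)

lemma vexit_Var_iff: "vexit \<delta> W qs p (Var i) w j p' \<longleftrightarrow> w = 0 \<and> j = i \<and> p' = p"
  by (subst vexit.simps) auto

lemma vstop_VNode_iff:
  "vstop \<delta> C W qs p (VNode a vs) n \<longleftrightarrow> n \<in> C p a (map (vrun \<delta> qs) vs) \<or>
    (\<exists>w j p' c. (w, j, p') \<in> W p a (map (vrun \<delta> qs) vs) \<and> j < length vs \<and>
      vstop \<delta> C W qs p' (vs ! j) c \<and> n = w + c)"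
  by (subst vstop.simps) auto

lemma vexit_VNode_iff:
  "vexit \<delta> W qs p (VNode a vs) n i p'' \<longleftrightarrow>
    (\<exists>w j p' w'. (w, j, p') \<in> W p a (map (vrun \<delta> qs) vs) \<and> j < length vs \<and>
      vexit \<delta> W qs p' (vs ! j) w' i p'' \<and> n = w + w')"
  by (subst vexit.simps) auto

text \<open>A path leaves \<open>v\<close> through one occurrence of one variable, so a single tree
  \<open>us ! i\<close> is continued however often it is copied. All other substituted trees
  contribute only their look-ahead states.\<close>

lemma path_value_subst_iff:
  assumes "v \<in> vtrees Dl (length us)"
  shows "path_value \<delta> C W p (subst us v) n \<longleftrightarrow> vstop \<delta> C W (map (run \<delta>) us) p v n \<or>
    (\<exists>w i p' m. vexit \<delta> W (map (run \<delta>) us) p v w i p' \<and> path_value \<delta> C W p' (us ! i) m \<and> n = w + m)"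
  using assms
proof (induction arbitrary: p n rule: vtrees.induct)
  case (1 i)
  then show ?case by (simp add: vstop_Var vexit_Var_iff)
next
  case (2 a vs)
  let ?qs = "map (run \<delta>) us"
  have runs: "map (run \<delta>) (map (subst us) vs) = map (vrun \<delta> ?qs) vs"
    using run_subst[OF 2(2)] by simp
  have IH: "path_value \<delta> C W q (map (subst us) vs ! j) m \<longleftrightarrow> vstop \<delta> C W ?qs q (vs ! j) m \<or>
    (\<exists>w i p' k. vexit \<delta> W ?qs q (vs ! j) w i p' \<and> path_value \<delta> C W p' (us ! i) k \<and> m = w + k)"
    if "j < length vs" for q j m
    using 2 that by simp
  have "path_value \<delta> C W p (subst us (VNode a vs)) n \<longleftrightarrow> n \<in> C p a (map (vrun \<delta> ?qs) vs) \<or>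
    (\<exists>w j q m. (w, j, q) \<in> W p a (map (vrun \<delta> ?qs) vs) \<and> j < length vs \<and>
      (vstop \<delta> C W ?qs q (vs ! j) m \<or>
       (\<exists>w i p' k. vexit \<delta> W ?qs q (vs ! j) w i p' \<and> path_value \<delta> C W p' (us ! i) k \<and> m = w + k)) \<and>
      n = w + m)"
    unfolding subst.simps path_value_Node_iff runs length_map using IH by (simp cong: conj_cong)
  also have "\<dots> \<longleftrightarrow> (n \<in> C p a (map (vrun \<delta> ?qs) vs) \<or>
      (\<exists>w j q m. (w, j, q) \<in> W p a (map (vrun \<delta> ?qs) vs) \<and> j < length vs \<and>
        vstop \<delta> C W ?qs q (vs ! j) m \<and> n = w + m)) \<or>
    (\<exists>v i p' k. (\<exists>w j q w'. (w, j, q) \<in> W p a (map (vrun \<delta> ?qs) vs) \<and> j < length vs \<and>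
        vexit \<delta> W ?qs q (vs ! j) w' i p' \<and> v = w + w') \<and> path_value \<delta> C W p' (us ! i) k \<and> n = v + k)"
    (is "?L \<longleftrightarrow> ?R")
  proof
    assume ?L
    then show ?R
    proof (elim disjE exE conjE, goal_cases)
      case (3 w j q m w' i p' k)
      then have "n = (w + w') + k" by simp
      with 3 show ?case by blast
    qed blast+
  next
    assume ?R
    then show ?L
    proof (elim disjE exE conjE, goal_cases)
      case (3 v i p' k w j q w')
      then have "n = w + (w' + k)" by simp
      with 3 show ?case by blast
    qed blast+
  qed
  finally show ?case unfolding vstop_VNode_iff vexit_VNode_iff .
qed

lemma vexit_var: "vexit \<delta> W qs p v w i p' \<Longrightarrow> v \<in> vtrees Dl k \<Longrightarrow> i < k"
proof (induction rule: vexit.induct)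
  case (1 p i)
  then show ?case by (auto elim: vtrees.cases)
next
  case (2 w j p' p a vs w' i p'')
  have "vs ! j \<in> vtrees Dl k" using 2(2) by (cases rule: vtrees.cases[OF 2(5)]) auto
  then show ?case using 2 by blast
qed

lemma vtree_encode_nth: "j < length vs \<Longrightarrow> vtree_encode (vs ! j) < vtree_encode (VNode a vs)"
proof -
  assume "j < length vs"
  then have "vtree_encode (vs ! j) < list_encode (map vtree_encode vs)" by (intro less_list_encode) auto
  then show ?thesis using le_prod_encode_2[of "list_encode (map vtree_encode vs)" "Suc a"] by simp
qed

text \<open>Each step inside \<open>v\<close> adds less than \<open>N\<close> and moves to a child
  with a smaller code, so the code of \<open>v\<close> bounds the number of steps; the extra
  \<open>N\<close> is for the final stop value.\<close>

lemma vstop_bound: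
  assumes "vstop \<delta> C W qs p v c" "path_bounded N \<delta>' I C W"
  shows "c < N * Suc (vtree_encode v)"
  using assms(1)
proof (induction rule: vstop.induct)
  case (1 c p a vs)
  then have "c < N" using path_boundedD(3)[OF assms(2)] by blast
  then show ?case by (simp add: trans_less_add1)
next
  case (2 w j p' p a vs c)
  have "w < N" using path_boundedD(4)[OF assms(2)] 2(1) by blast
  moreover have "N * Suc (vtree_encode (vs ! j)) \<le> N * vtree_encode (VNode a vs)"
    using vtree_encode_nth[OF 2(2)] by (intro mult_le_mono2) (simp add: Suc_leI)
  ultimately show ?case using 2(4) by simp
qed

lemma vexit_bound:
  assumes "vexit \<delta> W qs p v w i p'" "path_bounded N \<delta>' I C W" "p < N"
  shows "w \<le> N * vtree_encode v \<and> p' < N"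
  using assms(1,3)
proof (induction rule: vexit.induct)
  case (2 w j p' p a vs w' i p'')
  have "w < N" "p' < N" using path_boundedD(4)[OF assms(2)] 2(1) by blast+
  moreover have "N * Suc (vtree_encode (vs ! j)) \<le> N * vtree_encode (VNode a vs)"
    using vtree_encode_nth[OF 2(2)] by (intro mult_le_mono2) (simp add: Suc_leI)
  ultimately show ?case using 2(4) by simp
qed simp

text \<open>A node of \<open>t\<close> becomes one step that traverses its whole right-hand side.
  Look-ahead and path states stay below \<open>N\<close>; only weights and stop values grow, by at
  most the factor \<open>D\<close>. A right-hand side that is a bare variable gives a step of weight
  0, so pumping has to cope with such steps.\<close>

lemma path_recognizable_hom:
  fixes S :: "nat tree \<Rightarrow> nat set"
  assumes "path_recognizable N S"
    and h: "\<And>k a. h k a \<in> vtrees Dl k" "\<And>k a. vtree_encode (h k a) < D"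
  shows "path_recognizable (N * D) (\<lambda>t. S (hom h t))"
proof -
  obtain \<delta> I C W where b: "path_bounded N \<delta> I C W"
    and S: "\<And>t n. n \<in> S t \<longleftrightarrow> (\<exists>p \<in> I (run \<delta> t). path_value \<delta> C W p t n)"
    using assms(1) unfolding path_recognizable_def by blast
  have "0 < D" using h(2)[of undefined undefined] by simp
  then have "N \<le> N * D" by simp
  define \<gamma> where "\<gamma> a qs = (if set qs \<subseteq> {..<N} then vrun \<delta> qs (h (length qs) a) else 0)" for a qs
  have \<gamma>_less: "\<gamma> a qs < N" for a qs
    unfolding \<gamma>_def using vrun_less[OF h(1)] path_boundedD(1)[OF b] path_bounded_pos[OF b] by auto
  have run: "run \<gamma> t = run \<delta> (hom h t)" for t
  proof (induction t)
    case (Node a ts)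
    have "run \<gamma> t < N" for t by (cases t) (simp add: \<gamma>_less)
    then have "set (map (run \<gamma>) ts) \<subseteq> {..<N}" by auto
    then have "run \<gamma> (Node a ts) = vrun \<delta> (map (run \<gamma>) ts) (h (length ts) a)"
      unfolding run.simps by (subst \<gamma>_def) simp
    also have "map (run \<gamma>) ts = map (run \<delta>) (map (hom h) ts)" using Node by simp
    also have "vrun \<delta> \<dots> (h (length ts) a) = run \<delta> (hom h (Node a ts))"
      using run_subst[of "h (length ts) a" Dl "map (hom h) ts" \<delta>] h(1) by simp
    finally show ?case .
  qed
  then have runs: "map (run \<gamma>) ts = map (run \<delta>) (map (hom h) ts)" for ts by simp
  let ?C = "\<lambda>p a qs. {c. vstop \<delta> C W qs p (h (length qs) a) c}"
  \<comment> \<open>At a bare variable \<open>vexit\<close> returns its start state, so the guard is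
    what keeps the targets bounded. Walks started in \<open>I\<close> never leave the range below
    \<open>N\<close>.\<close>
  let ?W = "\<lambda>p a qs. {(w, i, p'). p < N \<and> vexit \<delta> W qs p (h (length qs) a) w i p'}"
  have pv: "path_value \<gamma> ?C ?W p t n \<longleftrightarrow> path_value \<delta> C W p (hom h t) n" if "p < N" for p t n
    using that
  proof (induction t arbitrary: p n)
    case (Node a ts)
    have v: "h (length ts) a \<in> vtrees Dl (length (map (hom h) ts))" using h(1) by simp
    have IH: "path_value \<gamma> ?C ?W p' (ts ! i) m \<longleftrightarrow> path_value \<delta> C W p' (map (hom h) ts ! i) m \<and> i < length ts"
      if "vexit \<delta> W (map (run \<gamma>) ts) p (h (length ts) a) w i p'" for w i p' m
    proof -
      have "i < length ts" using vexit_var[OF that h(1)] .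
      moreover have "p' < N" using vexit_bound[OF that b Node(2)] by simp
      ultimately show ?thesis using Node(1)[of "ts ! i" p' m] by simp
    qed
    have "path_value \<gamma> ?C ?W p (Node a ts) n \<longleftrightarrow> vstop \<delta> C W (map (run \<gamma>) ts) p (h (length ts) a) n \<or>
      (\<exists>w i p' m. vexit \<delta> W (map (run \<gamma>) ts) p (h (length ts) a) w i p' \<and>
        path_value \<delta> C W p' (map (hom h) ts ! i) m \<and> n = w + m)"
      unfolding path_value_Node_iff using IH vexit_var[OF _ h(1)] Node(2) by (auto; blast)
    then show ?case
      unfolding hom.simps path_value_subst_iff[OF v] runs .
  qed
  show ?thesis
  proof (rule path_recognizableI)
    show "path_bounded (N * D) \<gamma> I ?C ?W"
      unfolding path_bounded_def
    proof (intro conjI allI impI)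
      show "\<gamma> a qs < N * D" for a qs using \<gamma>_less \<open>N \<le> N * D\<close> by (rule less_le_trans)
      show "I q \<subseteq> {..<N * D}" for q
        using path_boundedD(2)[OF b, of q] \<open>N \<le> N * D\<close> by (meson lessThan_subset_iff subset_trans)
      fix p a and qs :: "nat list"
      have le: "N * Suc (vtree_encode (h (length qs) a)) \<le> N * D"
        using h(2) by (intro mult_le_mono2) (simp add: Suc_leI)
      show "?C p a qs \<subseteq> {..<N * D}"
      proof
        fix c assume "c \<in> ?C p a qs"
        then show "c \<in> {..<N * D}" using less_le_trans[OF vstop_bound[OF _ b] le] by blast
      qed
      show "?W p a qs \<subseteq> {..<N * D} \<times> UNIV \<times> {..<N * D}"
      proof
        fix x assume "x \<in> ?W p a qs"
        then obtain w i p' where x: "x = (w, i, p')" and "p < N" "vexit \<delta> W qs p (h (length qs) a) w i p'"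
          by blast
        then have "w \<le> N * vtree_encode (h (length qs) a)" "p' < N" using vexit_bound[OF _ b] by blast+
        then show "x \<in> {..<N * D} \<times> UNIV \<times> {..<N * D}"
          using le \<open>N \<le> N * D\<close> path_bounded_pos[OF b] by (simp add: x)
      qed
    qed
    show "n \<in> S (hom h t) \<longleftrightarrow> (\<exists>p \<in> I (run \<gamma> t). path_value \<gamma> ?C ?W p t n)" for t n
      unfolding S run using pv path_boundedD(2)[OF b] by (meson lessThan_iff subsetD)
  qed
qed

subsection \<open>Pumping\<close>

text \<open>
  \<open>X (p, q)\<close> collects the values obtainable from path state \<open>p\<close> on some tree with look-ahead
  state \<open>q\<close>. Along a path the maximum of a finite \<open>X\<close> strictly decreases at every step of
  positive weight, so there are few such steps.
\<close>

lemma path_value_pump: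
  assumes b: "path_bounded N \<delta> I C W" and X: "\<And>v. X v = {n. \<exists>t. run \<delta> t = snd v \<and> path_value \<delta> C W (fst v) t n}"
    and pv: "path_value \<delta> C W p t n" and fin: "finite (X (p, run \<delta> t))"
  shows "n \<le> N + N * card {v \<in> {..<N} \<times> {..<N}. finite (X v) \<and> X v \<noteq> {} \<and> Max (X v) < Max (X (p, run \<delta> t))}"
  using pv fin
proof (induction rule: path_value.induct)
  case (stop c p a ts)
  then have "c < N" using path_boundedD(3)[OF b] by blast
  then show ?case by simp
next
  case (step w j p' p a ts n)
  let ?v = "(p, run \<delta> (Node a ts))" and ?v' = "(p', run \<delta> (ts ! j))"
  let ?low = "\<lambda>v. {u \<in> {..<N} \<times> {..<N}. finite (X u) \<and> X u \<noteq> {} \<and> Max (X u) < Max (X v)}"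
  have run: "run \<delta> t < N" for t using path_boundedD(1)[OF b] by (rule run_less)
  have "w < N" "p' < N" using path_boundedD(4)[OF b] step(1) by blast+
  \<comment> \<open>A witness for \<open>m\<close> has the same look-ahead state as the subtree it
    replaces, so the step remains possible and the state at the root is unchanged.\<close>
  have shift: "w + m \<in> X ?v" if m: "m \<in> X ?v'" for m
  proof -
    obtain t' where t': "run \<delta> t' = run \<delta> (ts ! j)" "path_value \<delta> C W p' t' m"
      using m unfolding X by auto
    have runs: "map (run \<delta>) (ts[j := t']) = map (run \<delta>) ts"
      by (simp add: map_update t'(1) list_update_same_conv step(2))
    have "path_value \<delta> C W p (Node a (ts[j := t'])) (w + m)"
    proof (rule path_value.step)
      show "(w, j, p') \<in> W p a (map (run \<delta>) (ts[j := t']))" unfolding runs by (rule step(1))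
      show "j < length (ts[j := t'])" "path_value \<delta> C W p' (ts[j := t'] ! j) m" using step(2) t'(2) by simp_all
    qed
    moreover have "run \<delta> (Node a (ts[j := t'])) = run \<delta> (Node a ts)" unfolding run.simps runs ..
    ultimately show ?thesis unfolding X fst_conv snd_conv mem_Collect_eq by blast
  qed
  have "finite ((+) w ` X ?v')" by (rule finite_subset[OF _ step(5)]) (use shift in blast)
  then have fin': "finite (X ?v')" by (rule finite_imageD) simp
  have "n \<in> X ?v'" using step(3) unfolding X by auto
  then have ne: "X ?v' \<noteq> {}" by blast
  have max: "w + Max (X ?v') \<le> Max (X ?v)"
    using shift[OF Max_in[OF fin' ne]] step(5) by simp
  have fin_low: "finite (?low v)" for v by simp
  show ?case
  proof (cases "w = 0")
    \<comment> \<open>Such a step need not lower the maximum, but it adds nothing to the value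
      either.\<close>
    case True
    then have "?low ?v' \<subseteq> ?low ?v" using max by auto
    then have "card (?low ?v') \<le> card (?low ?v)" by (rule card_mono[OF fin_low])
    then have "N * card (?low ?v') \<le> N * card (?low ?v)" by simp
    then show ?thesis using step(4)[OF fin'] True by linarith
  next
    case False
    then have less: "Max (X ?v') < Max (X ?v)" using max by simp
    \<comment> \<open>The pair \<open>?v'\<close> lies below \<open>?v\<close> but not below itself.
      So every step of positive weight uses up a further pair and costs less than
      \<open>N\<close>.\<close>
    have "?low ?v' \<subseteq> ?low ?v" using less_trans[OF _ less] by blast
    moreover have "?v' \<in> {..<N} \<times> {..<N}" using \<open>p' < N\<close> run by simp
    then have "?v' \<in> ?low ?v" using fin' ne less by blast
    ultimately have "insert ?v' (?low ?v') \<subseteq> ?low ?v" by blast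
    then have "card (insert ?v' (?low ?v')) \<le> card (?low ?v)" by (rule card_mono[OF fin_low])
    then have "Suc (card (?low ?v')) \<le> card (?low ?v)" using fin_low by (subst (asm) card_insert_disjoint) auto
    then have "N * Suc (card (?low ?v')) \<le> N * card (?low ?v)" by (rule mult_le_mono2)
    then show ?thesis using step(4)[OF fin'] \<open>w < N\<close> by simp
  qed
qed

text \<open>There are only \<open>N * N\<close> pairs of states, so a value beyond
  \<open>N + N * (N * N)\<close> forces an infinite \<open>X\<close>. Its members occur on trees
  with the same root look-ahead state, for which \<open>p\<close> is still an initial path
  state.\<close>

lemma path_recognizable_pump_up:
  assumes "path_recognizable N S" "n \<in> S t" "N + N * (N * N) < n"
  shows "\<exists>t' n'. n' \<in> S t' \<and> m \<le> n'"
proof -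
  obtain \<delta> I C W where b: "path_bounded N \<delta> I C W"
    and S: "\<And>t n. n \<in> S t \<longleftrightarrow> (\<exists>p \<in> I (run \<delta> t). path_value \<delta> C W p t n)"
    using assms(1) unfolding path_recognizable_def by blast
  obtain p where p: "p \<in> I (run \<delta> t)" "path_value \<delta> C W p t n" using assms(2) S by blast
  define X where "X v = {n. \<exists>t. run \<delta> t = snd v \<and> path_value \<delta> C W (fst v) t n}" for v :: "nat \<times> nat"
  have "infinite (X (p, run \<delta> t))"
  proof
    assume "finite (X (p, run \<delta> t))"
    then have le: "n \<le> N + N * card {v \<in> {..<N} \<times> {..<N}. finite (X v) \<and> X v \<noteq> {} \<and> Max (X v) < Max (X (p, run \<delta> t))}"
      by (rule path_value_pump[OF b X_def p(2)])
    have "card {v \<in> {..<N} \<times> {..<N}. finite (X v) \<and> X v \<noteq> {} \<and> Max (X v) < Max (X (p, run \<delta> t))} \<le>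
        card ({..<N} \<times> {..<N})" by (rule card_mono) auto
    also have "\<dots> = N * N" by (simp add: card_cartesian_product)
    finally have "N * card {v \<in> {..<N} \<times> {..<N}. finite (X v) \<and> X v \<noteq> {} \<and> Max (X v) < Max (X (p, run \<delta> t))} \<le>
        N * (N * N)" by (rule mult_le_mono2)
    then show False using le assms(3) by linarith
  qed
  then obtain n' where "m \<le> n'" "n' \<in> X (p, run \<delta> t)"
    unfolding finite_nat_set_iff_bounded_le by (meson nat_le_linear)
  moreover from this obtain t' where "run \<delta> t' = run \<delta> t" "path_value \<delta> C W p t' n'" unfolding X_def by auto
  ultimately show ?thesis using p(1) S by metis
qed

text \<open>
  The least heights of the trees with a given value form an initial segment of the natural
  numbers: a tree of least height whose subtrees have been replaced by trees of least height
  still has least height.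
\<close>

lemma ex_small_tree:
  fixes \<phi> :: "'a tree \<Rightarrow> 's"
  assumes comp: "\<And>a ts ts'. map \<phi> ts = map \<phi> ts' \<Longrightarrow> \<phi> (Node a ts) = \<phi> (Node a ts')"
    and fin: "finite (range \<phi>)"
  shows "\<exists>t'. \<phi> t' = \<phi> t \<and> height t' < card (range \<phi>)"
proof -
  define m where "m s = (LEAST h. \<exists>t. \<phi> t = s \<and> height t = h)" for s
  have m_le: "m (\<phi> t) \<le> height t" for t unfolding m_def by (rule Least_le) blast
  have m_ex: "\<exists>t'. \<phi> t' = \<phi> t \<and> height t' = m (\<phi> t)" for t
    unfolding m_def by (rule LeastI[of _ "height t"]) blast
  then obtain r where r: "\<And>t. \<phi> (r t) = \<phi> t" "\<And>t. height (r t) = m (\<phi> t)" by metis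
  have pred: "\<exists>u. m (\<phi> u) = k" if "m (\<phi> t) = Suc k" for t k
  proof -
    obtain a ts where rt: "r t = Node a ts" by (cases "r t")
    have h: "height (Node a ts) = Suc k" using r(2)[of t] that rt by simp
    have "\<phi> (Node a (map r ts)) = \<phi> (Node a ts)" by (rule comp) (simp add: r)
    also have "\<dots> = \<phi> t" using r(1)[of t] rt by simp
    finally have "Suc k \<le> height (Node a (map r ts))" using m_le[of "Node a (map r ts)"] that by simp
    \<comment> \<open>Some representative among the new children has height at least
      \<open>k\<close>, while the old children have height at most \<open>k\<close>. A
      representative is no higher than the tree it replaces, so equality holds for this
      child.\<close>
    then obtain u where u: "u \<in> set ts" "k \<le> height (r u)" by (auto simp: le_height_iff simp del: height.simps)
    have "height u < Suc k" using h u(1) height_le_iff[of a ts "Suc k"] by auto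
    then have "m (\<phi> u) = k" using u(2) m_le[of u] r(2)[of u] by simp
    then show ?thesis by blast
  qed
  have down: "\<exists>u. m (\<phi> u) = k" if "k \<le> m (\<phi> t)" for k
    using that by (induction rule: inc_induct) (use pred in blast)+
  have "{..m (\<phi> t)} \<subseteq> m ` range \<phi>" using down by force
  then have "card {..m (\<phi> t)} \<le> card (range \<phi>)" using fin by (meson card_image_le card_mono finite_imageI le_trans)
  then show ?thesis using m_ex[of t] by (auto simp: Suc_le_eq)
qed

text \<open>Values above \<open>B\<close> need not be told apart. Trees are classified by their
  look-ahead state and the set of pairs of path state and value cut off at \<open>Suc B\<close>; the
  \<open>N\<close> states and \<open>2 ^ (N * (B + 2))\<close> sets give the bound on the height of
  least representatives.\<close>

lemma path_recognizable_small_tree: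
  assumes "path_recognizable N S" "n \<in> S t" "B < n"
  shows "\<exists>t' n'. n' \<in> S t' \<and> B < n' \<and> height t' < N * 2 ^ (N * (B + 2))"
proof -
  obtain \<delta> I C W where b: "path_bounded N \<delta> I C W"
    and S: "\<And>t n. n \<in> S t \<longleftrightarrow> (\<exists>p \<in> I (run \<delta> t). path_value \<delta> C W p t n)"
    using assms(1) unfolding path_recognizable_def by blast
  define V where "V t = {(p, min n (Suc B)) |p n. p < N \<and> path_value \<delta> C W p t n}" for t
  let ?\<phi> = "\<lambda>t. (run \<delta> t, V t)"
  have sub: "V (Node a ts) \<subseteq> V (Node a ts')" if eq: "map ?\<phi> ts = map ?\<phi> ts'" for a ts ts'
  proof
    fix x assume "x \<in> V (Node a ts)"
    then obtain p n where x: "x = (p, min n (Suc B))" "p < N" and pv: "path_value \<delta> C W p (Node a ts) n"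
      unfolding V_def by blast
    have len: "length ts = length ts'" using eq by (rule map_eq_imp_length_eq)
    have "map fst (map ?\<phi> ts) = map fst (map ?\<phi> ts')" using eq by (rule arg_cong)
    then have runs: "map (run \<delta>) ts = map (run \<delta>) ts'" by (simp only: map_map comp_def fst_conv)
    from pv consider "n \<in> C p a (map (run \<delta>) ts)"
      | w j q k where "(w, j, q) \<in> W p a (map (run \<delta>) ts)" "j < length ts"
        "path_value \<delta> C W q (ts ! j) k" "n = w + k"
      unfolding path_value_Node_iff by blast
    then show "x \<in> V (Node a ts')"
    proof cases
      case 1
      then have "path_value \<delta> C W p (Node a ts') n" unfolding runs by (rule path_value.stop)
      then show ?thesis using x unfolding V_def by blast
    next
      case 2
      have "q < N" using path_boundedD(4)[OF b] 2(1) by blast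
      then have "(q, min k (Suc B)) \<in> V (ts ! j)" using 2(3) unfolding V_def by blast
      moreover have "?\<phi> (ts ! j) = ?\<phi> (ts' ! j)" using arg_cong[OF eq, of "\<lambda>l. l ! j"] 2(2) len by simp
      ultimately have "(q, min k (Suc B)) \<in> V (ts' ! j)" by simp
      then obtain k' where k': "path_value \<delta> C W q (ts' ! j) k'" "min k' (Suc B) = min k (Suc B)"
        unfolding V_def by auto
      have "path_value \<delta> C W p (Node a ts') (w + k')"
        using 2(1,2) k'(1) len unfolding runs by (intro path_value.step) simp_all
      \<comment> \<open>The cut-off value of \<open>w + k\<close> depends only on the cut-off value
        of \<open>k\<close>, which makes the classification compositional.\<close>
      moreover have "min (w + k') (Suc B) = min n (Suc B)" using k'(2) 2(4) by linarith
      then have "x = (p, min (w + k') (Suc B))" using x(1) by simp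
      ultimately show ?thesis using x(2) unfolding V_def by blast
    qed
  qed
  have comp: "?\<phi> (Node a ts) = ?\<phi> (Node a ts')" if "map ?\<phi> ts = map ?\<phi> ts'" for a ts ts'
  proof -
    have "map fst (map ?\<phi> ts) = map fst (map ?\<phi> ts')" using that by (rule arg_cong)
    then have "run \<delta> (Node a ts) = run \<delta> (Node a ts')" by (simp only: run.simps map_map comp_def fst_conv)
    then show ?thesis using sub[OF that] sub[OF that[symmetric]] by blast
  qed
  have range: "range ?\<phi> \<subseteq> {..<N} \<times> Pow ({..<N} \<times> {..<B + 2})"
    using run_less[OF path_boundedD(1)[OF b]] unfolding V_def by auto
  then have fin: "finite (range ?\<phi>)" by (rule finite_subset) simp
  have card: "card (range ?\<phi>) \<le> N * 2 ^ (N * (B + 2))"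
    using card_mono[OF _ range] by (simp add: card_cartesian_product card_Pow)
  obtain t' where t': "?\<phi> t' = ?\<phi> t" "height t' < card (range ?\<phi>)" using ex_small_tree[OF comp fin] by blast
  obtain p where p: "p \<in> I (run \<delta> t)" "path_value \<delta> C W p t n" using assms(2) S by blast
  have "p < N" using p(1) path_boundedD(2)[OF b] by blast
  then have "(p, min n (Suc B)) \<in> V t" using p(2) unfolding V_def by blast
  then have "(p, min n (Suc B)) \<in> V t'" using t'(1) by simp
  then obtain n' where "path_value \<delta> C W p t' n'" "min n' (Suc B) = min n (Suc B)" unfolding V_def by auto
  then have "n' \<in> S t'" "B < n'" using S p(1) t'(1) assms(3) by auto
  then show ?thesis using t'(2) card by (meson less_le_trans)
qed

subsection \<open>Inverse images under the basic transformations\<close>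

text \<open>Path automata read every tree of the type, but transformations act on trees over a
  ranked alphabet. A look-ahead with state 1 on such trees and 0 on all others cuts down the
  domain.\<close>

lemma path_recognizable_trees:
  assumes "path_recognizable N S"
  shows "path_recognizable (N * 2) (\<lambda>t. if t \<in> trees Sg then S t else {})"
proof -
  let ?\<delta> = "\<lambda>a qs. of_bool (a \<in> Sg (length qs) \<and> set qs \<subseteq> {1}) :: nat"
  have run: "run ?\<delta> t = of_bool (t \<in> trees Sg)" for t
  proof (induction t)
    case (Node a ts)
    then have "set (map (run ?\<delta>) ts) \<subseteq> {1} \<longleftrightarrow> (\<forall>t \<in> set ts. of_bool (t \<in> trees Sg) = (1::nat))"
      by (simp only: set_map image_subset_iff singleton_iff cong: ball_cong)
    then have "set (map (run ?\<delta>) ts) \<subseteq> {1} \<longleftrightarrow> set ts \<subseteq> trees Sg" by auto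
    then show ?case unfolding run.simps Node_in_trees_iff by simp
  qed
  have "path_recognizable (N * 2) (\<lambda>t. if run ?\<delta> t \<in> {1} then S t else {})"
    by (rule path_recognizable_restrict[OF assms]) simp
  moreover have "run ?\<delta> t \<in> {1} \<longleftrightarrow> t \<in> trees Sg" for t unfolding run by simp
  ultimately show ?thesis by (simp only: cong: if_cong)
qed

text \<open>Entries of a coded list are smaller than its code, so the states of \<open>D\<close> are
  at most \<open>x\<close>. The factor 2 pays for testing membership in
  \<open>trees\<close>.\<close>

lemma path_recognizable_lang_of_fta:
  assumes D: "valid_fta D" "fta_encode D \<le> x" and S: "path_recognizable N S"
  shows "path_recognizable (N * Suc x * 2) (\<lambda>t. if t \<in> lang_of_fta D then S t else {})"
proof (cases D)
  case (FtaDesc A Q F T)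
  have fta: "fta (alph_of A) (set Q) (set F) (\<lambda>a qs. table_fun T (a, qs))" using D FtaDesc by simp
  have Q: "q < Suc x" if "q \<in> set Q" for q
  proof -
    have "list_encode Q < fta_encode D" unfolding FtaDesc fta_encode.simps by (rule less_list_encode) simp
    then show ?thesis using less_list_encode[OF that] D(2) by simp
  qed
  \<comment> \<open>The product construction needs a bound on all arguments, so values outside the
    range are replaced by 0. Runs on trees over the alphabet are not affected.\<close>
  let ?\<delta> = "\<lambda>a qs. if table_fun T (a, qs) < Suc x then table_fun T (a, qs) else 0"
  have table: "?\<delta> a qs = table_fun T (a, qs)" if "a \<in> alph_of A (length qs)" "set qs \<subseteq> set Q" for a qs
    using fta that Q unfolding fta_def by simp
  have run: "run ?\<delta> t = run (\<lambda>a qs. table_fun T (a, qs)) t" if "t \<in> trees (alph_of A)" for t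
    using run_cong[OF that fta table] by simp
  have "path_recognizable (N * Suc x) (\<lambda>t. if run ?\<delta> t \<in> set F then S t else {})"
    by (rule path_recognizable_restrict[OF S]) simp
  then have "path_recognizable (N * Suc x * 2)
      (\<lambda>t. if t \<in> trees (alph_of A) then if run ?\<delta> t \<in> set F then S t else {} else {})"
    by (rule path_recognizable_trees)
  moreover have "(\<lambda>t. if t \<in> trees (alph_of A) then if run ?\<delta> t \<in> set F then S t else {} else {}) =
      (\<lambda>t. if t \<in> lang_of_fta D then S t else {})"
    unfolding FtaDesc lang_of_fta.simps fta_lang_def by (intro ext) (simp only: run mem_Collect_eq cong: if_cong, simp)
  ultimately show ?thesis by simp
qed

text \<open>A single growth function for all three kinds lets the total bound be a plain iteration.
  It dominates \<open>4 ^ N * 2\<close> for relabelings, \<open>N * (Suc x * 2)\<close> for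
  restrictions and \<open>N * ((x + 3) * 2)\<close> for homomorphisms.\<close>

lemma path_recognizable_trans:
  assumes E: "valid_trans E" "trans_encode E \<le> x" and S: "path_recognizable N S"
  shows "path_recognizable (4 ^ (N + x + 2)) (\<lambda>t. \<Union>u \<in> trans_of E `` {t}. S u)"
proof -
  have bound: "k * l \<le> 4 ^ (N + x + 2)" if "k \<le> 4 ^ N" "l \<le> (x + 3) * 2" for k l :: nat
  proof -
    have "x + 3 \<le> 2 ^ (x + 2)" using less_exp[of "x + 2"] by linarith
    then have "(x + 3) * 2 \<le> 2 ^ (x + 2) * 2 ^ (x + 2)" by (intro mult_le_mono) auto
    also have "\<dots> = 4 ^ (x + 2)" by (simp only: flip: power_mult_distrib) simp
    finally have "k * l \<le> 4 ^ N * 4 ^ (x + 2)" using that by (meson le_trans mult_le_mono)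
    then show ?thesis by (simp only: add.assoc power_add)
  qed
  have N: "N \<le> 4 ^ N" using less_exp[of N] power_mono[of "2::nat" 4 N] by linarith
  show ?thesis
  proof (cases E)
    case (RelDesc A B R)
    let ?r = "\<lambda>k a. {b. (a, k, b) \<in> set R}"
    have "path_recognizable (4 ^ N * 2) (\<lambda>t. if t \<in> trees (alph_of A) then \<Union>u \<in> {u. relabels ?r t u}. S u else {})"
      by (intro path_recognizable_trees path_recognizable_relabels S)
    moreover have "(\<lambda>t. if t \<in> trees (alph_of A) then \<Union>u \<in> {u. relabels ?r t u}. S u else {}) =
        (\<lambda>t. \<Union>u \<in> trans_of E `` {t}. S u)"
      by (rule ext) (auto simp: RelDesc rel_trans_def)
    ultimately have "path_recognizable (4 ^ N * 2) (\<lambda>t. \<Union>u \<in> trans_of E `` {t}. S u)" by (simp only:)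
    then show ?thesis by (rule path_recognizable_mono[OF _ bound]) simp_all
  next
    case (RestrDesc D)
    have "fta_encode D < trans_encode E" unfolding RestrDesc trans_encode.simps by (rule less_list_encode) simp
    then have "path_recognizable (N * Suc x * 2) (\<lambda>t. if t \<in> lang_of_fta D then S t else {})"
      using E RestrDesc by (intro path_recognizable_lang_of_fta S) simp_all
    moreover have "(\<lambda>t. if t \<in> lang_of_fta D then S t else {}) = (\<lambda>t. \<Union>u \<in> trans_of E `` {t}. S u)"
      by (rule ext) (auto simp: RestrDesc)
    ultimately have "path_recognizable (N * (Suc x * 2)) (\<lambda>t. \<Union>u \<in> trans_of E `` {t}. S u)"
      by (simp only: mult.assoc)
    then show ?thesis by (rule path_recognizable_mono[OF _ bound[OF N]]) simp
  next
    case (HomDesc A B H)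
    \<comment> \<open>The inverse image lemma asks for a right-hand side for every symbol and rank.
      Outside the input alphabet a leaf is supplied, and the output alphabet is relaxed to all
      symbols.\<close>
    define h where "h k a = (if (a, k) \<in> set A then table_fun H (a, k) else VNode 0 [])" for k a
    have vars: "h k a \<in> vtrees (\<lambda>_. UNIV) k" for k a
    proof (cases "(a, k) \<in> set A")
      case True
      have weaken: "v \<in> vtrees (\<lambda>_. UNIV) k" if "v \<in> vtrees (alph_of B) k" for v
        using that by (induction rule: vtrees.induct) (auto intro: vtrees.intros)
      have "table_fun H (a, k) \<in> vtrees (alph_of B) k"
        using E(1) True by (simp add: HomDesc homomorphism_def alph_of_def)
      then show ?thesis using True weaken by (simp add: h_def)
    next
      case False
      then show ?thesis by (auto simp: h_def intro: vtrees.intros)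
    qed
    have small: "vtree_encode (h k a) < x + 3" for k a
    proof (cases "(a, k) \<in> set A")
      case True
      then have "(a, k) \<in> fst ` set H" using E(1) HomDesc by auto
      then obtain v where "map_of H (a, k) = Some v" by (metis map_of_eq_None_iff option.exhaust)
      then have v: "((a, k), v) \<in> set H" "h k a = v" using True by (auto simp: h_def table_fun_def dest: map_of_SomeD)
      have "vtree_encode v < list_encode [a, k, vtree_encode v]" by (rule less_list_encode) simp
      also have "\<dots> < list_encode (map (\<lambda>((a, k), v). list_encode [a, k, vtree_encode v]) H)"
        using v(1) by (intro less_list_encode) force
      also have "\<dots> < trans_encode E" unfolding HomDesc trans_encode.simps by (rule less_list_encode) simp
      finally show ?thesis using E(2) v(2) by simp
    next
      case False
      \<comment> \<open>The supplied leaf has code \<open>prod_encode (1, 0) = 2\<close>, which is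
        the origin of the 3 in \<open>x + 3\<close>.\<close>
      then show ?thesis by (simp add: h_def prod_encode_def list_encode.simps)
    qed
    have "path_recognizable (N * (x + 3) * 2) (\<lambda>t. if t \<in> trees (alph_of A) then S (hom h t) else {})"
      by (intro path_recognizable_trees path_recognizable_hom[OF S vars small])
    moreover have "(\<lambda>t. if t \<in> trees (alph_of A) then S (hom h t) else {}) = (\<lambda>t. \<Union>u \<in> trans_of E `` {t}. S u)"
    proof
      fix t
      have "hom h t = hom (\<lambda>k a. table_fun H (a, k)) t" if "t \<in> trees (alph_of A)"
        using that by (rule hom_cong) (simp add: h_def alph_of_def)
      then show "(if t \<in> trees (alph_of A) then S (hom h t) else {}) = (\<Union>u \<in> trans_of E `` {t}. S u)"
        by (auto simp: HomDesc hom_trans_def)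
    qed
    ultimately have "path_recognizable (N * ((x + 3) * 2)) (\<lambda>t. \<Union>u \<in> trans_of E `` {t}. S u)"
      by (simp only: mult.assoc)
    then show ?thesis by (rule path_recognizable_mono[OF _ bound[OF N]]) simp
  qed
qed

text \<open>\<open>E\<close> is applied before \<open>Es\<close>, so the induction starts at the
  output, with the height automaton and its bound 2, and takes inverse images towards the
  input.\<close>

lemma path_recognizable_compose:
  assumes "\<forall>E \<in> set Es. valid_trans E \<and> trans_encode E \<le> x"
  shows "path_recognizable (((\<lambda>N. 4 ^ (N + x + 2)) ^^ length Es) 2)
    (\<lambda>t. \<Union>u \<in> compose (map trans_of Es) `` {t}. {..height u})"
  using assms
proof (induction Es)
  case Nil
  then show ?case using path_recognizable_height by (simp add: compose_def)
next
  case (Cons E Es)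
  have "(\<Union>u \<in> compose (map trans_of (E # Es)) `` {t}. {..height u}) =
      (\<Union>s \<in> trans_of E `` {t}. \<Union>u \<in> compose (map trans_of Es) `` {s}. {..height u})" for t
    by (auto simp: compose_def)
  then show ?case using path_recognizable_trans[of E x] Cons by simp
qed

section \<open>Finite output alphabets\<close>

lemma relabels_in_trees:
  assumes "s \<in> trees Sg" "\<And>k a. a \<in> Sg k \<Longrightarrow> r k a \<subseteq> Dl k" "relabels r s t"
  shows "t \<in> trees Dl"
  using assms(1,3)
proof (induction arbitrary: t rule: trees.induct)
  case (1 a ts)
  then obtain b us where *: "b \<in> r (length ts) a" "list_all2 (relabels r) ts us" "t = Node b us"
    unfolding relabels_Node_iff by blast
  have "set us \<subseteq> trees Dl"
  proof
    fix u assume "u \<in> set us"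
    then obtain i where "i < length us" "u = us ! i" by (auto simp: in_set_conv_nth)
    then show "u \<in> trees Dl" using *(2) "1.IH"[OF nth_mem[of i ts]] by (simp add: list_all2_conv_all_nth)
  qed
  moreover have "b \<in> Dl (length us)"
    using *(1) assms(2)[OF 1(1)] list_all2_lengthD[OF *(2)] by auto
  ultimately show ?case using *(3) by (simp add: Node_in_trees_iff)
qed

lemma subst_in_trees:
  "v \<in> vtrees Dl (length us) \<Longrightarrow> set us \<subseteq> trees Dl \<Longrightarrow> subst us v \<in> trees Dl"
proof (induction rule: vtrees.induct)
  case (1 i)
  then show ?case using nth_mem by fastforce
next
  case (2 a vs)
  then show ?case by (auto simp: Node_in_trees_iff)
qed

lemma hom_in_trees:
  assumes "homomorphism Sg Dl h" "s \<in> trees Sg" shows "hom h s \<in> trees Dl"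
  using assms(2)
proof (induction rule: trees.induct)
  case (1 a ts)
  have "h (length ts) a \<in> vtrees Dl (length (map (hom h) ts))"
    using 1(1) assms(1) by (simp add: homomorphism_def)
  then show ?case using 1 by (simp, intro subst_in_trees) auto
qed

lemma trans_of_range:
  assumes "valid_trans E" shows "\<exists>A. trans_of E `` X \<subseteq> trees (alph_of A)"
proof (cases E)
  case (RelDesc A B R)
  then have "t \<in> trees (alph_of B)" if "(s, t) \<in> trans_of E" for s t
    using that assms relabels_in_trees[of s "alph_of A" "\<lambda>k a. {b. (a, k, b) \<in> set R}" "alph_of B" t]
    by (simp add: rel_trans_def relabeling_def)
  then show ?thesis by blast
next
  case (RestrDesc D)
  then have "trans_of E `` X \<subseteq> lang_of_fta D" by auto
  moreover obtain A Q F T where "D = FtaDesc A Q F T" by (cases D)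
  ultimately show ?thesis by (intro exI[of _ A]) (auto simp: fta_lang_def)
next
  case (HomDesc A B H)
  then show ?thesis using assms
    by (intro exI[of _ B]) (auto simp: hom_trans_def intro: hom_in_trees)
qed

text \<open>The last stage confines all outputs to one finite alphabet, whereas an empty composition
  would return \<open>X\<close> itself. This turns infinitely many outputs into outputs of unbounded
  height.\<close>

lemma compose_range:
  "Es \<noteq> [] \<Longrightarrow> \<forall>E \<in> set Es. valid_trans E \<Longrightarrow>
    \<exists>A. compose (map trans_of Es) `` X \<subseteq> trees (alph_of A)"
proof (induction Es arbitrary: X)
  case (Cons E Es)
  show ?case
  proof (cases "Es = []")
    case True
    then show ?thesis using trans_of_range[of E X] Cons.prems by (simp add: compose_def)
  next
    case False
    then show ?thesis using Cons.IH[of "trans_of E `` X"] Cons.prems by (simp add: compose_def relcomp_Image)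
  qed
qed simp

lemma finite_trees_below: "finite {t \<in> trees (alph_of A). height t < h}"
  unfolding set_trees_below[symmetric] by (rule finite_set)

section \<open>The bounds and the decision procedure\<close>

definition stages :: "nat \<Rightarrow> nat list" where
  "stages n = list_encode [1, fst (prod_decode n)] # list_decode (snd (prod_decode n))"

text \<open>The input language counts as a first stage, a restriction with tag 1, so that
  \<open>U\<close> becomes the image of all trees. The code of the list of stages exceeds the code
  of each stage and serves as their common parameter \<open>x\<close>.\<close>

definition state_bound :: "nat \<Rightarrow> nat" where
  "state_bound n = ((\<lambda>N. 4 ^ (N + list_encode (stages n) + 2)) ^^ length (stages n)) 2"

text \<open>The threshold of \<open>path_recognizable_pump_up\<close>; \<open>input_bound\<close> is
  the height bound of \<open>path_recognizable_small_tree\<close> with this threshold as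
  \<open>B\<close>.\<close>

definition output_bound :: "nat \<Rightarrow> nat" where
  "output_bound n = state_bound n + state_bound n * (state_bound n * state_bound n)"

definition input_bound :: "nat \<Rightarrow> nat" where
  "input_bound n = state_bound n * 2 ^ (state_bound n * (output_bound n + 2))"

text \<open>Item 0 of the first component is the alphabet of the input automaton. Enumerating trees
  over it is enough, because the first stage discards all others.\<close>

definition decide_finite :: "nat \<Rightarrow> nat" where
  "decide_finite n = of_bool (\<not> list_ex (\<lambda>u. output_bound n < height u)
     (fold (\<lambda>E ts. concat (map (images E) ts)) (stages n)
       (trees_below (item 0 (fst (prod_decode n))) (input_bound n))))"

lemma computable_decide_finite: "computable decide_finite"
proof -
  have "computable stages" unfolding stages_def by (intro computable_intros)
  then have [computable_intros]: "computable (\<lambda>x. stages (f x))" if "computable f" for f :: "'x::encodable \<Rightarrow> nat"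
    using that by (rule computable_compose)
  have "computable state_bound" unfolding state_bound_def by (intro computable_intros)
  then have [computable_intros]: "computable (\<lambda>x. state_bound (f x))" if "computable f" for f :: "'x::encodable \<Rightarrow> nat"
    using that by (rule computable_compose)
  have "computable output_bound" unfolding output_bound_def by (intro computable_intros)
  then have [computable_intros]: "computable (\<lambda>x. output_bound (f x))" if "computable f" for f :: "'x::encodable \<Rightarrow> nat"
    using that by (rule computable_compose)
  have [computable_intros]: "computable input_bound" unfolding input_bound_def by (intro computable_intros)
  show ?thesis unfolding decide_finite_def by (intro computable_intros)
qed

lemma decide_finite_correct:
  assumes "describes d U" shows "decide_finite (surface_encode d) = (if finite U then 1 else 0)"
proof (cases d)
  case (SurfaceDesc D Ds)
  let ?n = "surface_encode d" and ?Es = "RestrDesc D # Ds"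
  let ?M = "compose (map trans_of ?Es)" and ?N = "state_bound ?n" and ?B = "output_bound ?n"
  obtain A Q F T where D: "D = FtaDesc A Q F T" by (cases D)
  have valid: "\<forall>E \<in> set ?Es. valid_trans E" and U: "U = ?M `` UNIV"
    using assms by (auto simp: SurfaceDesc compose_def)
  have stages: "stages ?n = map trans_encode ?Es" by (simp add: SurfaceDesc stages_def)
  have "trans_encode E \<le> list_encode (stages ?n)" if "E \<in> set ?Es" for E
    unfolding stages using that by (intro less_imp_le less_list_encode) auto
  then have rec: "path_recognizable ?N (\<lambda>t. \<Union>u \<in> ?M `` {t}. {..height u})"
    using path_recognizable_compose[of ?Es "list_encode (stages ?n)"] valid
    by (simp add: state_bound_def stages)
  have "set (trees_below (item 0 (fst (prod_decode ?n))) h) = {t \<in> trees (alph_of A). height t < h}" for h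
    by (simp add: SurfaceDesc D set_trees_below)
  then have decide: "decide_finite ?n = of_bool (\<not> (\<exists>u \<in> ?M `` {t \<in> trees (alph_of A). height t < input_bound ?n}. ?B < height u))"
    unfolding decide_finite_def stages list_ex_iff set_fold_images[OF valid] by simp
  have "infinite U \<longleftrightarrow> (\<exists>u \<in> ?M `` {t \<in> trees (alph_of A). height t < input_bound ?n}. ?B < height u)"
  proof
    assume inf: "infinite U"
    obtain A' where "U \<subseteq> trees (alph_of A')" unfolding U using compose_range[OF _ valid, of UNIV] by blast
    \<comment> \<open>Over a finite alphabet only finitely many trees have bounded height.\<close>
    then have "\<not> (\<forall>u \<in> U. height u < Suc ?B)"
      using inf finite_subset[OF _ finite_trees_below[of A' "Suc ?B"]] by blast
    then obtain t u where u: "(t, u) \<in> ?M" "?B < height u" unfolding U by (auto simp: not_less_eq)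
    have "height u \<in> (\<Union>u \<in> ?M `` {t}. {..height u})" using u(1) by blast
    from path_recognizable_small_tree[OF rec this u(2)]
    obtain t' n' where t': "n' \<in> (\<Union>u \<in> ?M `` {t'}. {..height u})" "?B < n'" "height t' < input_bound ?n"
      unfolding input_bound_def by blast
    \<comment> \<open>The value \<open>n'\<close> is only a lower bound for the height of an output,
      which suffices for exceeding \<open>?B\<close>.\<close>
    then obtain u' where u': "(t', u') \<in> ?M" "n' \<le> height u'" by blast
    \<comment> \<open>The small tree was found among all trees of the type; having an output, it
      passes the first stage and so belongs to the input language.\<close>
    have "t' \<in> lang_of_fta D" using u'(1) by (auto simp: compose_def)
    then have "t' \<in> trees (alph_of A)" by (simp add: D fta_lang_def)
    then show "\<exists>u \<in> ?M `` {t \<in> trees (alph_of A). height t < input_bound ?n}. ?B < height u"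
      using u' t'(2,3) by (intro bexI[of _ u']) auto
  next
    assume "\<exists>u \<in> ?M `` {t \<in> trees (alph_of A). height t < input_bound ?n}. ?B < height u"
    then obtain t u where u: "(t, u) \<in> ?M" "?B < height u" by blast
    have "height u \<in> (\<Union>u \<in> ?M `` {t}. {..height u})" using u(1) by blast
    note pump = path_recognizable_pump_up[OF rec this u(2)[unfolded output_bound_def]]
    show "infinite U"
    proof
      assume "finite U"
      then have fin: "finite (height ` U)" by simp
      obtain t' n' where "n' \<in> (\<Union>u \<in> ?M `` {t'}. {..height u})" "Suc (Max (height ` U)) \<le> n'"
        using pump by blast
      then obtain u' where "u' \<in> U" "Suc (Max (height ` U)) \<le> height u'" unfolding U by fastforce
      then show False using Max_ge[OF fin, of "height u'"] by simp
    qed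
  qed
  then show ?thesis unfolding decide by auto
qed

theorem theorem4p90:
  "\<exists>p. \<forall>U \<in> Surface. \<forall>d. describes d U \<longrightarrow>
     computes p [surface_encode d] (if finite U then 1 else 0)"
proof -
  obtain p where p: "\<And>n. computes p [n] (decide_finite n)"
    using computable_decide_finite unfolding computable_def enc_nat_def by blast
  have "computes p [surface_encode d] (if finite U then 1 else 0)" if "describes d U" for d U
    using p[of "surface_encode d"] unfolding decide_finite_correct[OF that] .
  then show ?thesis by blast
qed

end
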